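(* Let $A=\{A^i\in\mathcal{M}_D\}_{i=1}^d$ be a tensor in irreducible form whose transfer matrix $E_A=\sum_{i=1}^d A^i\otimes\bar A^i$ is a quantum channel. Then $\mathcal{V}(A)$ has a coarse continuum limit if and only if there exists an $n\in\mathbb{N}$ such that $E_A^n$ is infinitely divisible.
   Context: $\mathcal{M}_D$ is the set of complex $D\times D$ matrices; $\mathbb{N}=\{1,2,\dots\}$; $D,d$ are finite. A tensor $A=\{A^i\in\mathcal{M}_D\}_{i=1}^d$ generates, for every $N\in\mathbb{N}$, the matrix product state $|V_N(A)\rangle=\sum_{i_1,\dots,i_N=1}^d\mathrm{Tr}(A^{i_1}\cdots A^{i_N})|i_1,\dots,i_N\rangle$, and the family $\mathcal{V}(A)=\{|V_N(A)\rangle\}_{N\in\mathbb{N}}$. Transfer matrix: $E_A=\sum_i A^i\otimes\bar A^i$ (bar = complex conjugation), identified with the completely positive map $\mathcal{E}(X)=\sum_i A^iXA^{i\dagger}$ on $\mathcal{M}_D$. A quantum channel is a trace-preserving completely positive map. Powers denote composition. Throughout, tensors are in irreducible form, i.e. $A^i=\bigoplus_j\mu_jA^i_j$ with $\mu_j>0$ and each $E_{A_j}$ an irreducible completely positive map (spectral radius 1, with 1 a non-degenerate eigenvalue; other eigenvalues of modulus 1 are allowed), and their transfer matrices are quantum channels. A quantum channel $E$ is infinitely divisible if for every $m\in\mathbb{N}$ there is a quantum channel $E_m$ with $E_m^m=E$. Refinement: $\mathcal{V}(A)$ is an $n$-refinement of $\mathcal{V}(B)$ if there is an isometry $W$ from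 the physical space of one site of $B$ into the space of $n$ sites of $A$ with $|V_{nN}(A)\rangle=W^{\otimes N}|V_N(B)\rangle$ for all $N\in\mathbb{N}$. For every $A$ and $n$ such a $B$ exists and it is essentially unique (up to a unitary on the physical index); at the level of transfer matrices, $\mathcal{V}(A)$ being the $n$-refinement of $\mathcal{V}(B)$ corresponds to $E_B=E_A^n$. Continuum limit (in terms of transfer matrices): $\mathcal{V}(B)$ has a continuum limit if there exist an integer $p>1$, quantum channels $\{E_{p^\ell}\}_{\ell\in\mathbb{N}}$ with $E_{p^\ell}^{p^\ell}=E_B$ for all $\ell$, and a matrix $Q$, such that for all sequences $(n_k,\ell_k)_{k\ge1}$ in $\mathbb{N}\times\mathbb{N}$ with $\lim_{k\to\infty}n_k/p^{\ell_k}=0$ one has $\lim_{k\to\infty}E_{p^{\ell_k}}^{\,n_k}=Q$. Coarse continuum limit: $\mathcal{V}(A)$ has a coarse continuum limit if there are a $\mathcal{V}(B)$ and an $n\in\mathbb{N}$ such that $\mathcal{V}(A)$ is the $n$-refinement of $\mathcal{V}(B)$ (i.e. $E_B=E_A^n$) and $\mathcal{V}(B)$ has a continuum limit. *)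

theory Defs
  imports "HOL-Analysis.Analysis"
begin

text \<open>
  The bond space has the finite type \<open>'n\<close> as its basis, so the bond dimension is \<open>CARD('n)\<close> and
  \<open>D \<times> D\<close> matrices have type \<open>complex^'n^'n\<close>. A tensor of physical dimension \<open>d\<close> is a family
  \<open>A :: nat \<Rightarrow> complex^'n^'n\<close> of which only \<open>A 0, \<dots>, A (d - 1)\<close> matter; keeping \<open>d\<close> a number
  allows one to quantify existentially over tensors of arbitrary physical dimension.
\<close>

subsection \<open>Matrices\<close>

definition dagger :: "complex^'n^'m \<Rightarrow> complex^'m^'n" where
  "dagger M = (\<chi> i j. cnj (M $ j $ i))"

definition conj_matrix :: "complex^'n^'m \<Rightarrow> complex^'n^'m" where
  "conj_matrix M = (\<chi> i j. cnj (M $ i $ j))"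

definition kron :: "complex^'n^'m \<Rightarrow> complex^'l^'k \<Rightarrow> complex^('n::finite \<times> 'l::finite)^('m \<times> 'k)" where
  "kron M M' = (\<chi> x y. M $ fst x $ fst y * M' $ snd x $ snd y)"

text \<open>The type class power \<open>M ^ k\<close> is the entrywise one on \<open>complex^'n^'n\<close>.\<close>

primrec matrix_power :: "complex^'n^'n \<Rightarrow> nat \<Rightarrow> complex^'n^'n" where
  "matrix_power M 0 = mat 1"
| "matrix_power M (Suc k) = M ** matrix_power M k"


subsection \<open>Superoperators and quantum channels\<close>

text \<open>
  A \<open>D\<^sup>2 \<times> D\<^sup>2\<close> matrix is identified with a linear map on \<open>D \<times> D\<close> matrices through
  \<open>|a\<rangle>\<langle>b| \<mapsto> |a, b\<rangle>\<close>. Under this identification the matrix product is composition, and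
  \<open>kron M (conj_matrix M)\<close> is the map \<open>X \<mapsto> M X M\<^sup>\<dagger>\<close>; see \<open>superop_mult\<close> and
  \<open>superop_transfer_matrix\<close> below.
\<close>

definition superop :: "complex^('n::finite \<times> 'n)^('n \<times> 'n) \<Rightarrow> complex^'n^'n \<Rightarrow> complex^'n^'n" where
  "superop E X = (\<chi> a b. \<Sum>y\<in>UNIV. E $ (a, b) $ y * X $ fst y $ snd y)"

text \<open>
  An element of \<open>M\<^sub>k(M\<^sub>D)\<close> is given by its blocks \<open>X p q\<close> with \<open>p, q < k\<close>. Over the complex
  numbers, a nonnegative quadratic form already forces the matrix to be Hermitian.
\<close>

definition psd_block :: "nat \<Rightarrow> (nat \<Rightarrow> nat \<Rightarrow> complex^'n^'n) \<Rightarrow> bool" where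
  "psd_block k X \<longleftrightarrow>
     (\<forall>v :: nat \<Rightarrow> complex^'n.
        (\<Sum>p<k. \<Sum>q<k. \<Sum>a\<in>UNIV. \<Sum>b\<in>UNIV. cnj (v p $ a) * X p q $ a $ b * v q $ b) \<in> \<real>\<^sub>\<ge>\<^sub>0)"

definition completely_positive :: "complex^('n::finite \<times> 'n)^('n \<times> 'n) \<Rightarrow> bool" where
  "completely_positive E \<longleftrightarrow>
     (\<forall>k X. psd_block k X \<longrightarrow> psd_block k (\<lambda>p q. superop E (X p q)))"

definition trace_preserving :: "complex^('n::finite \<times> 'n)^('n \<times> 'n) \<Rightarrow> bool" where
  "trace_preserving E \<longleftrightarrow> (\<forall>X. trace (superop E X) = trace X)"

definition quantum_channel :: "complex^('n::finite \<times> 'n)^('n \<times> 'n) \<Rightarrow> bool" where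
  "quantum_channel E \<longleftrightarrow> completely_positive E \<and> trace_preserving E"

definition infinitely_divisible :: "complex^('n::finite \<times> 'n)^('n \<times> 'n) \<Rightarrow> bool" where
  "infinitely_divisible E \<longleftrightarrow>
     quantum_channel E \<and> (\<forall>m\<ge>1. \<exists>F. quantum_channel F \<and> matrix_power F m = E)"


subsection \<open>Matrix product states\<close>

definition transfer_matrix :: "nat \<Rightarrow> (nat \<Rightarrow> complex^'n^'n) \<Rightarrow> complex^('n::finite \<times> 'n)^('n \<times> 'n)" where
  "transfer_matrix d A = (\<Sum>i<d. kron (A i) (conj_matrix (A i)))"

text \<open>
  The basis of \<open>N\<close> sites of dimension \<open>d\<close>; vectors and operators on these sites are given by their
  coefficients in this basis.
\<close>

definition configs :: "nat \<Rightarrow> nat \<Rightarrow> nat list set" where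
  "configs d N = {is. length is = N \<and> set is \<subseteq> {..<d}}"

text \<open>\<open>mps A is\<close> is the coefficient of \<open>|V\<^sub>N(A)\<rangle>\<close> at \<open>|is\<rangle>\<close>, where \<open>N = length is\<close>.\<close>

definition mps :: "(nat \<Rightarrow> complex^'n^'n) \<Rightarrow> nat list \<Rightarrow> complex" where
  "mps A is = trace (foldr (\<lambda>i M. A i ** M) is (mat 1))"

text \<open>\<open>W is j\<close> is the matrix element \<open>\<langle>is| W |j\<rangle>\<close> of a map from one site to several sites.\<close>

definition isometry_to_sites :: "nat \<Rightarrow> nat \<Rightarrow> nat \<Rightarrow> (nat list \<Rightarrow> nat \<Rightarrow> complex) \<Rightarrow> bool" where
  "isometry_to_sites d n e W \<longleftrightarrow>
     (\<forall>j<e. \<forall>k<e. (\<Sum>is\<in>configs d n. cnj (W is j) * W is k) = (if j = k then 1 else 0))"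

text \<open>
  \<open>\<V>(A)\<close> is an \<open>n\<close>-refinement of \<open>\<V>(B)\<close>. A configuration of \<open>n N\<close> sites is written as the
  concatenation of \<open>N\<close> configurations of \<open>n\<close> sites.
\<close>

definition is_refinement ::
  "nat \<Rightarrow> nat \<Rightarrow> (nat \<Rightarrow> complex^'n^'n) \<Rightarrow> nat \<Rightarrow> (nat \<Rightarrow> complex^'m^'m) \<Rightarrow> bool" where
  "is_refinement n d A e B \<longleftrightarrow>
     (\<exists>W. isometry_to_sites d n e W \<and>
        (\<forall>N\<ge>1. \<forall>iss. length iss = N \<and> set iss \<subseteq> configs d n \<longrightarrow>
           mps A (concat iss) = (\<Sum>js\<in>configs e N. (\<Prod>k<N. W (iss ! k) (js ! k)) * mps B js)))"


subsection \<open>Irreducible form\<close>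

text \<open>
  A direct sum decomposition of the matrices is given by a partition of the basis \<open>'n\<close> into sets
  \<open>S\<close>; the matrices of the summand belonging to \<open>S\<close> are the elements of \<open>corner S\<close>.
\<close>

definition corner :: "'n set \<Rightarrow> (complex^'n^'n) set" where
  "corner S = {X. \<forall>a b. X $ a $ b \<noteq> 0 \<longrightarrow> a \<in> S \<and> b \<in> S}"

definition corner_one :: "'n set \<Rightarrow> complex^'n^'n" where
  "corner_one S = (\<chi> a b. if a = b \<and> a \<in> S then 1 else 0)"

definition eigenspace_on :: "'n set \<Rightarrow> complex^('n::finite \<times> 'n)^('n \<times> 'n) \<Rightarrow> complex \<Rightarrow> (complex^'n^'n) set" where
  "eigenspace_on S E c = {X \<in> corner S. superop E X = (\<chi> a b. c * X $ a $ b)}"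

definition spectrum_on :: "'n set \<Rightarrow> complex^('n::finite \<times> 'n)^('n \<times> 'n) \<Rightarrow> complex set" where
  "spectrum_on S E = {c. \<exists>X\<in>eigenspace_on S E c. X \<noteq> 0}"

text \<open>
  \<open>E\<close> restricted to \<open>corner S\<close> is irreducible: no orthogonal projection \<open>P\<close> other than \<open>0\<close> and the
  identity satisfies \<open>E(P M P) \<subseteq> P M P\<close> for \<open>M = corner S\<close>. It is normalised to spectral radius 1,
  and the eigenvalue 1 is non-degenerate.
\<close>

definition irreducible_on :: "'n set \<Rightarrow> complex^('n::finite \<times> 'n)^('n \<times> 'n) \<Rightarrow> bool" where
  "irreducible_on S E \<longleftrightarrow>
     (\<forall>P\<in>corner S. P ** P = P \<and> dagger P = P \<and>
        (\<forall>X\<in>corner S. \<exists>Y\<in>corner S. superop E (P ** X ** P) = P ** Y ** P)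
        \<longrightarrow> P = 0 \<or> P = corner_one S)"

definition irreducible_block :: "'n set \<Rightarrow> complex^('n::finite \<times> 'n)^('n \<times> 'n) \<Rightarrow> bool" where
  "irreducible_block S E \<longleftrightarrow>
     irreducible_on S E \<and>
     Max (cmod ` spectrum_on S E) = 1 \<and>
     (\<exists>X. X \<noteq> 0 \<and> eigenspace_on S E 1 = {Y. \<exists>c. Y = (\<chi> a b. c * X $ a $ b)})"

text \<open>
  \<open>A\<^sup>i = \<Oplus>\<^sub>j \<mu>\<^sub>j A\<^sup>i\<^sub>j\<close>, with \<open>A\<^sup>i\<^sub>j\<close> written \<open>C j i\<close>. The maps \<open>E\<^bsub>A\<^sub>j\<^esub>\<close> are completely positive by
  construction.
\<close>

definition irreducible_form :: "nat \<Rightarrow> (nat \<Rightarrow> complex^'n^'n) \<Rightarrow> bool" where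
  "irreducible_form d A \<longleftrightarrow>
     (\<exists>(r::nat) (S :: nat \<Rightarrow> 'n set) (\<mu> :: nat \<Rightarrow> real) (C :: nat \<Rightarrow> nat \<Rightarrow> complex^'n^'n).
        (\<Union>j<r. S j) = UNIV \<and>
        (\<forall>j<r. \<forall>k<r. j \<noteq> k \<longrightarrow> S j \<inter> S k = {}) \<and>
        (\<forall>j<r. S j \<noteq> {} \<and> \<mu> j > 0 \<and> (\<forall>i<d. C j i \<in> corner (S j)) \<and>
               irreducible_block (S j) (transfer_matrix d (C j))) \<and>
        (\<forall>i<d. A i = (\<Sum>j<r. \<mu> j *\<^sub>R C j i)))"


subsection \<open>Continuum limits\<close>

text \<open>\<open>F l\<close> is the root \<open>E\<^bsub>p^l\<^esub>\<close>.\<close>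

definition has_continuum_limit :: "nat \<Rightarrow> (nat \<Rightarrow> complex^'n^'n) \<Rightarrow> bool" where
  "has_continuum_limit d B \<longleftrightarrow>
     (\<exists>(p::nat) (F :: nat \<Rightarrow> complex^('n::finite \<times> 'n)^('n \<times> 'n)) Q. p > 1 \<and>
        (\<forall>l\<ge>1. quantum_channel (F l) \<and> matrix_power (F l) (p ^ l) = transfer_matrix d B) \<and>
        (\<forall>(n :: nat \<Rightarrow> nat) (l :: nat \<Rightarrow> nat).
           (\<forall>k. n k \<ge> 1 \<and> l k \<ge> 1) \<and> (\<lambda>k. real (n k) / real (p ^ l k)) \<longlonglongrightarrow> 0
           \<longrightarrow> (\<lambda>k. matrix_power (F (l k)) (n k)) \<longlonglongrightarrow> Q))"

text \<open>
  The equation between the transfer matrices fixes the bond basis of the coarse tensor \<open>B\<close>, whose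
  physical dimension \<open>e\<close> is arbitrary. No irreducible form of \<open>B\<close> is demanded: the blocking
  of an irreducible tensor with period 2 is in general block diagonal only after a unitary change of bond basis.
\<close>

definition has_coarse_continuum_limit :: "nat \<Rightarrow> (nat \<Rightarrow> complex^'n^'n) \<Rightarrow> bool" where
  "has_coarse_continuum_limit d A \<longleftrightarrow>
     (\<exists>n\<ge>1. \<exists>e. \<exists>B :: nat \<Rightarrow> complex^'n^'n.
        is_refinement n d A e B \<and>
        transfer_matrix e B = matrix_power (transfer_matrix d A) n \<and>
        has_continuum_limit e B)"


subsection \<open>The identification of matrices with superoperators\<close>

lemma superop_add: "superop (E + F) X = superop E X + superop F X"
  by (simp add: superop_def vec_eq_iff distrib_right sum.distrib)

lemma superop_mult: "superop (E ** F) X = superop E (superop F X)"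
proof -
  have "(\<Sum>y\<in>UNIV. (\<Sum>z\<in>UNIV. E $ (a, b) $ z * F $ z $ y) * X $ fst y $ snd y)
      = (\<Sum>z\<in>UNIV. E $ (a, b) $ z * (\<Sum>y\<in>UNIV. F $ (fst z, snd z) $ y * X $ fst y $ snd y))" for a b
  proof -
    have "(\<Sum>y\<in>UNIV. (\<Sum>z\<in>UNIV. E $ (a, b) $ z * F $ z $ y) * X $ fst y $ snd y)
        = (\<Sum>y\<in>UNIV. \<Sum>z\<in>UNIV. E $ (a, b) $ z * F $ z $ y * X $ fst y $ snd y)"
      by (simp add: sum_distrib_right)
    also have "\<dots> = (\<Sum>z\<in>UNIV. \<Sum>y\<in>UNIV. E $ (a, b) $ z * F $ z $ y * X $ fst y $ snd y)"
      by (rule sum.swap)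
    finally show ?thesis
      by (simp add: sum_distrib_left mult.assoc)
  qed
  then show ?thesis
    by (simp add: superop_def matrix_matrix_mult_def vec_eq_iff)
qed

lemma superop_kron: "superop (kron M (conj_matrix M)) X = M ** X ** dagger M"
proof -
  have "(\<Sum>y\<in>UNIV. M $ a $ fst y * cnj (M $ b $ snd y) * X $ fst y $ snd y)
      = (\<Sum>k\<in>UNIV. (\<Sum>l\<in>UNIV. M $ a $ l * X $ l $ k) * cnj (M $ b $ k))" for a b
  proof -
    have "(\<Sum>y\<in>UNIV. M $ a $ fst y * cnj (M $ b $ snd y) * X $ fst y $ snd y)
        = (\<Sum>l\<in>UNIV. \<Sum>k\<in>UNIV. M $ a $ l * cnj (M $ b $ k) * X $ l $ k)"
      by (simp add: sum.cartesian_product case_prod_beta)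
    also have "\<dots> = (\<Sum>k\<in>UNIV. \<Sum>l\<in>UNIV. M $ a $ l * cnj (M $ b $ k) * X $ l $ k)"
      by (rule sum.swap)
    finally show ?thesis
      by (simp add: sum_distrib_left sum_distrib_right ac_simps)
  qed
  then show ?thesis
    by (simp add: superop_def kron_def conj_matrix_def dagger_def matrix_matrix_mult_def vec_eq_iff)
qed

lemma superop_transfer_matrix: "superop (transfer_matrix d A) X = (\<Sum>i<d. A i ** X ** dagger (A i))"
proof (induction d)
  case 0
  show ?case by (simp add: transfer_matrix_def superop_def vec_eq_iff)
next
  case (Suc d)
  then show ?case by (simp add: transfer_matrix_def superop_add superop_kron)
qed

end

theory Submission
  imports Defs
begin

text \<open>
  Channels of a fixed dimension form a compact monoid.

  If \<open>E\<close> has a continuum limit with roots \<open>F\<^sub>l\<close>, write \<open>p\<^sup>l = m n\<^sub>l + r\<^sub>l\<close> with \<open>1 \<le> r\<^sub>l \<le> m\<close>. Along a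
  subsequence \<open>F\<^sub>l\<close> to the power \<open>n\<^sub>l\<close> tends to a channel \<open>G\<close>, and \<open>F\<^sub>l\<close> to the power \<open>r\<^sub>l\<close> tends to the
  idempotent \<open>Q\<close>, so \<open>G Q\<close> is an \<open>m\<close>-th root of \<open>E\<close>.

  Conversely, let \<open>E\<close> be infinitely divisible. Compactness yields a chain \<open>G\<^sub>0 = E\<close>,
  \<open>G\<^bsub>l+1\<^esub>\<^sup>2 = G\<^sub>l\<close>, that is, a representation \<open>T\<close> of the positive dyadic rationals. The limit points of
  \<open>T(q)\<close> as \<open>q \<rightarrow> 0\<close> form a compact group with some identity \<open>Q\<close>. The group need not be trivial, so \<open>T\<close>
  itself need not converge. However, a channel of the closure of \<open>T\<close> that is close to \<open>Q\<close>, at a time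
  close to 0, has a square root there that is again close to \<open>Q\<close>: correct any square root by an
  involution of the group. Near \<open>Q\<close> such roots approach \<open>Q\<close> geometrically. Starting from
  \<open>T(c/2\<^sup>m)\<close> close to \<open>Q\<close>, one gets roots of \<open>T(c/2\<^sup>m)\<close>, hence of \<open>E\<^sup>c\<close>, whose small powers do tend
  to \<open>Q\<close>. The freedom to coarse-grain absorbs the exponent \<open>c\<close>.
\<close>

subsection \<open>Powers of matrices near an idempotent\<close>

lemma bounded_bilinear_matrix_mult:
  "bounded_bilinear ((**) :: complex^'n^'m \<Rightarrow> complex^'p^'n \<Rightarrow> complex^'p^'m)"
  unfolding bilinear_conv_bounded_bilinear[symmetric] bilinear_def
  by (intro conjI allI linearI)
    (simp_all add: matrix_matrix_mult_def vec_eq_iff distrib_left distrib_right sum.distrib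
      scaleR_sum_right)

lemmas tendsto_matrix_mult [tendsto_intros] =
  bounded_bilinear.tendsto[OF bounded_bilinear_matrix_mult]

lemma matrix_power_add: "matrix_power M (a + b) = matrix_power M a ** matrix_power M b"
  by (induction a) (simp_all add: matrix_mul_assoc)

lemma matrix_power_mult: "matrix_power M (a * b) = matrix_power (matrix_power M a) b"
  by (induction b) (simp_all add: matrix_power_add)

lemma matrix_power_commute:
  "matrix_power M a ** matrix_power M b = matrix_power M b ** matrix_power M a"
  by (metis add.commute matrix_power_add)

lemma matrix_power_double: "matrix_power M (2 * n) = matrix_power (M ** M) n"
  using matrix_power_mult[of M 2 n] by (simp add: numeral_2_eq_2)

lemma matrix_power_mult_distrib:
  assumes "M ** N = N ** M"
  shows "matrix_power (M ** N) k = matrix_power M k ** matrix_power N k"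
proof (induction k)
  case (Suc k)
  have "matrix_power M k ** N = N ** matrix_power M k"
    by (induction k) (simp, metis assms matrix_mul_assoc matrix_power.simps(2))
  then show ?case
    using Suc by (simp add: matrix_mul_assoc) (metis matrix_mul_assoc)
qed simp

lemma tendsto_matrix_power [tendsto_intros]:
  "(f \<longlongrightarrow> M) F \<Longrightarrow> ((\<lambda>x. matrix_power (f x) k) \<longlongrightarrow> matrix_power M k) F"
  by (induction k) (auto intro!: tendsto_intros)

text \<open>As \<open>Q\<close> is absorbed by \<open>U\<close> and \<open>V\<close>, the error of
  the product is the sum of both errors plus their product, which the smallness of
  \<open>U - Q\<close> bounds by the error of \<open>V\<close>.\<close>

lemma norm_diff_idempotent_mult_le:
  fixes Q U V :: "complex^'n^'n"
  assumes C: "\<And>(A :: complex^'n^'n) (B :: complex^'n^'n). norm (A ** B) \<le> norm A * norm B * C"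
    and "Q ** Q = Q" "U ** Q = U" "Q ** V = V" and "norm (U - Q) * C \<le> 1"
  shows "norm (U ** V - Q) \<le> norm (U - Q) + 2 * norm (V - Q)"
proof -
  have "U ** V - Q = (U - Q) + (V - Q) + (U - Q) ** (V - Q)"
    using assms(2-4)
    by (simp add: bounded_bilinear.diff_left[OF bounded_bilinear_matrix_mult]
        bounded_bilinear.diff_right[OF bounded_bilinear_matrix_mult])
  then have "norm (U ** V - Q) \<le> norm (U - Q) + norm (V - Q) + norm ((U - Q) ** (V - Q))"
    by (simp only:) (rule order_trans[OF norm_triangle_ineq add_right_mono[OF norm_triangle_ineq]])
  also have "norm ((U - Q) ** (V - Q)) \<le> norm (V - Q)"
    using C[of "U - Q" "V - Q"] mult_left_mono[OF assms(5), of "norm (V - Q)"]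
    by (simp add: ac_simps)
  finally show ?thesis by simp
qed

text \<open>
  Binary expansion: halving \<open>n\<close> passes from \<open>X j\<close> to \<open>X (j - 1)\<close>, and the subtracted term
  absorbs the contribution of an odd digit.
\<close>

lemma square_root_chain_power_bound:
  fixes X :: "nat \<Rightarrow> complex^'n^'n"
  assumes C: "\<And>(A :: complex^'n^'n) (B :: complex^'n^'n). norm (A ** B) \<le> norm A * norm B * C"
    and "Q ** Q = Q" and Q: "\<And>j. Q ** X j = X j" "\<And>j. X j ** Q = X j"
    and square: "\<And>j. X (Suc j) ** X (Suc j) = X j"
    and X: "\<And>j. norm (X j - Q) \<le> \<delta> * (2 / 3) ^ j"
    and "0 \<le> C" "6 * \<delta> * C \<le> 1"
  shows "1 \<le> n \<Longrightarrow> n < 2 ^ h \<Longrightarrow> h \<le> Suc j \<Longrightarrow>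
    norm (matrix_power (X j) n - Q) \<le> 6 * \<delta> * ((2 / 3) ^ (Suc j - h) - (2 / 3) ^ Suc j)"
proof (induction h arbitrary: n j)
  case (Suc h)
  have "0 \<le> \<delta>" using order_trans[OF norm_ge_zero X[of 0]] by simp
  define m where "m = n div 2"
  consider "n = 1" | "n = 2 * m" "1 \<le> m" | "n = Suc (2 * m)" "1 \<le> m"
    using Suc.prems(1) unfolding m_def by linarith
  then show ?case
  proof cases
    case 1
    have "(2 / 3 :: real) ^ j \<le> (2 / 3) ^ (j - h)"
      by (intro power_decreasing) auto
    then have "6 * \<delta> * (2 / 3) ^ j \<le> 6 * \<delta> * (2 / 3) ^ (j - h)"
      using \<open>0 \<le> \<delta>\<close> by (intro mult_left_mono) auto
    moreover have "0 \<le> \<delta> * (2 / 3) ^ j" using \<open>0 \<le> \<delta>\<close> by simp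
    ultimately have "\<delta> * (2 / 3) ^ j \<le> 6 * \<delta> * ((2 / 3) ^ (j - h) - (2 / 3) ^ Suc j)"
      by (simp add: algebra_simps)
    then show ?thesis using 1 X[of j] by simp
  next
    case 2
    then have "m < 2 ^ h" using Suc.prems by simp
    \<comment> \<open>From \<open>1 \<le> m\<close> and \<open>m < 2 ^ h\<close> the level
      \<open>j\<close> is positive, so the square of \<open>X j\<close> is again in the
      chain.\<close>
    then have "h \<noteq> 0" using 2 by (intro notI) simp
    then obtain i where i: "j = Suc i" "h \<le> Suc i" using Suc.prems by (cases j) auto
    have "matrix_power (X j) n = matrix_power (X i) m"
      by (simp add: 2 i matrix_power_double square)
    moreover have "(2 / 3 :: real) ^ Suc (Suc i) \<le> (2 / 3) ^ Suc i"
      by (intro power_decreasing) auto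
    then have "6 * \<delta> * ((2 / 3) ^ (Suc i - h) - (2 / 3) ^ Suc i)
        \<le> 6 * \<delta> * ((2 / 3) ^ (Suc i - h) - (2 / 3) ^ Suc (Suc i))"
      using \<open>0 \<le> \<delta>\<close> by (intro mult_left_mono) auto
    ultimately show ?thesis
      using Suc.IH[OF 2(2) \<open>m < 2 ^ h\<close> i(2)] by (simp only: i diff_Suc_Suc)
  next
    case 3
    then have "m < 2 ^ h" using Suc.prems by simp
    then have "h \<noteq> 0" using 3 by (intro notI) simp
    then obtain i where i: "j = Suc i" "h \<le> Suc i" using Suc.prems by (cases j) auto
    define U where "U = matrix_power (X i) m"
    have U: "norm (U - Q) \<le> 6 * \<delta> * ((2 / 3) ^ (Suc i - h) - (2 / 3) ^ Suc i)"
      unfolding U_def by (rule Suc.IH[OF 3(2) \<open>m < 2 ^ h\<close> i(2)])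
    have "matrix_power (X j) n = X j ** U"
      by (simp add: 3 i U_def matrix_power_double square)
    \<comment> \<open>The product estimate doubles the error of the right factor, so the single
      factor \<open>X j\<close> takes that place and the accumulated error enters with coefficient
      1.\<close>
    also have "\<dots> = U ** X j"
      using matrix_power_commute[of "X j" 1 "2 * m"]
      by (simp add: U_def i matrix_power_double square)
    finally have n: "matrix_power (X j) n = U ** X j" .
    have "(2 / 3 :: real) ^ (Suc i - h) \<le> 1"
      by (rule power_le_one) auto
    moreover have "0 \<le> (2 / 3 :: real) ^ Suc i" by simp
    ultimately have "(2 / 3 :: real) ^ (Suc i - h) - (2 / 3) ^ Suc i \<le> 1"
      by linarith
    then have "6 * \<delta> * ((2 / 3) ^ (Suc i - h) - (2 / 3) ^ Suc i) \<le> 6 * \<delta> * 1"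
      using \<open>0 \<le> \<delta>\<close> by (intro mult_left_mono) auto
    then have "norm (U - Q) * C \<le> 6 * \<delta> * C"
      using U \<open>0 \<le> C\<close> by (intro mult_right_mono) auto
    moreover have "U ** Q = U"
      using 3(2) matrix_power_add[of "X i" "m - 1" 1] Q
      by (simp add: U_def flip: matrix_mul_assoc)
    ultimately have "norm (U ** X j - Q) \<le> norm (U - Q) + 2 * norm (X j - Q)"
      using assms by (intro norm_diff_idempotent_mult_le[OF C]) auto
    also have "\<dots> \<le> 6 * \<delta> * ((2 / 3) ^ (Suc i - h) - (2 / 3) ^ Suc i) + 2 * (\<delta> * (2 / 3) ^ j)"
      using U X[of j] by simp
    \<comment> \<open>The constant 6 is \<open>2 / (1 - 2 / 3)\<close>: with it the added term
      \<open>2 * (\<delta> * (2 / 3) ^ j)\<close> telescopes exactly.\<close>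
    also have "\<dots> = 6 * \<delta> * ((2 / 3) ^ (Suc i - h) - (2 / 3) ^ Suc j)"
      by (simp add: i algebra_simps)
    also have "Suc i - h = Suc j - Suc h" by (simp add: i)
    finally show ?thesis by (simp only: n)
  qed
qed simp

text \<open>A ratio below \<open>1 / 2 ^ s\<close> means that \<open>n k\<close> has at most
  \<open>l k - s\<close> binary digits, so the bound on powers leaves an error of at most
  \<open>6 * \<delta> * (2 / 3) ^ Suc s\<close>, uniformly in the level.\<close>

lemma square_root_chain_power_tendsto:
  fixes X :: "nat \<Rightarrow> complex^'n^'n"
  assumes C: "\<And>(A :: complex^'n^'n) (B :: complex^'n^'n). norm (A ** B) \<le> norm A * norm B * C"
    and "Q ** Q = Q" "\<And>j. Q ** X j = X j" "\<And>j. X j ** Q = X j"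
    and "\<And>j. X (Suc j) ** X (Suc j) = X j"
    and X: "\<And>j. norm (X j - Q) \<le> \<delta> * (2 / 3) ^ j"
    and "0 \<le> C" "6 * \<delta> * C \<le> 1"
    and n: "\<And>k. 1 \<le> n k" "(\<lambda>k. real (n k) / 2 ^ l k) \<longlonglongrightarrow> 0"
  shows "(\<lambda>k. matrix_power (X (l k)) (n k)) \<longlonglongrightarrow> Q"
proof (rule LIMSEQ_I)
  fix \<epsilon> :: real
  assume "0 < \<epsilon>"
  have "0 \<le> \<delta>" using order_trans[OF norm_ge_zero X[of 0]] by simp
  have "(\<lambda>s. 6 * \<delta> * (2 / 3) ^ s) \<longlonglongrightarrow> 6 * \<delta> * 0"
    by (intro tendsto_mult tendsto_const LIMSEQ_power_zero) auto
  then have "\<forall>\<^sub>F s in sequentially. 6 * \<delta> * (2 / 3) ^ s < \<epsilon>"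
    using \<open>0 < \<epsilon>\<close> by (intro order_tendstoD) auto
  then obtain s where s: "6 * \<delta> * (2 / 3) ^ Suc s < \<epsilon>"
    unfolding eventually_sequentially by (meson le_SucI order_refl)
  have "\<forall>\<^sub>F k in sequentially. real (n k) / 2 ^ l k < 1 / 2 ^ s"
    using n(2) by (rule order_tendstoD) simp
  then obtain K where K: "\<And>k. K \<le> k \<Longrightarrow> real (n k) / 2 ^ l k < 1 / 2 ^ s"
    unfolding eventually_sequentially by blast
  have "norm (matrix_power (X (l k)) (n k) - Q) < \<epsilon>" if "K \<le> k" for k
  proof -
    have "real (n k * 2 ^ s) < real (2 ^ l k)"
      using K[OF that] by (simp add: field_simps)
    then have lt: "n k * 2 ^ s < 2 ^ l k" by (simp only: of_nat_less_iff)
    \<comment> \<open>Since \<open>n k\<close> is at least 1, this forces \<open>s < l k\<close>, so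
      the subtraction \<open>l k - s\<close> is exact.\<close>
    then have "2 ^ s < (2 :: nat) ^ l k"
      using n(1)[of k] by (metis le_less_trans mult_le_mono1 mult_1)
    then have "s < l k" by simp
    then have "n k < 2 ^ (l k - s)"
      using lt by (metis less_imp_le_nat le_add_diff_inverse2 power_add mult_less_cancel2)
    then have "norm (matrix_power (X (l k)) (n k) - Q)
        \<le> 6 * \<delta> * ((2 / 3) ^ (Suc (l k) - (l k - s)) - (2 / 3) ^ Suc (l k))"
      using assms(1-8) n(1) by (intro square_root_chain_power_bound) auto
    also have "Suc (l k) - (l k - s) = Suc s" using \<open>s < l k\<close> by simp
    also have "6 * \<delta> * ((2 / 3) ^ Suc s - (2 / 3) ^ Suc (l k)) \<le> 6 * \<delta> * (2 / 3) ^ Suc s"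
      using \<open>0 \<le> \<delta>\<close> by (intro mult_left_mono) auto
    finally show ?thesis using s by simp
  qed
  then show "\<exists>K. \<forall>k\<ge>K. norm (matrix_power (X (l k)) (n k) - Q) < \<epsilon>" by blast
qed

subsection \<open>Chains of square roots in a compact monoid\<close>

text \<open>Roots of \<open>X\<close> of different orders need not be compatible. The
  \<open>2 ^ l\<close>-th powers of \<open>2 ^ Suc l\<close>-th roots are square roots of
  \<open>X\<close> with ever more roots of their own; a limit point of them has roots of all orders
  \<open>2 ^ h\<close>, so the hypothesis on \<open>X\<close> passes on to it.\<close>

lemma infinitely_many_roots_imp_square_root:
  fixes S :: "(complex^'n^'n) set"
  assumes "compact S" and power: "\<And>X k. X \<in> S \<Longrightarrow> matrix_power X k \<in> S"
    and roots: "\<forall>l. \<exists>R\<in>S. matrix_power R (2 ^ l) = X"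
  shows "\<exists>Y. (\<forall>l. \<exists>R\<in>S. matrix_power R (2 ^ l) = Y) \<and> Y ** Y = X"
proof -
  obtain R where R: "\<And>l. R l \<in> S" "\<And>l. matrix_power (R l) (2 ^ l) = X"
    using roots by metis
  define Y where "Y l = matrix_power (R (Suc l)) (2 ^ l)" for l
  have "\<And>l. Y l \<in> S" using R power by (auto simp: Y_def)
  then obtain Y' r where r: "strict_mono r" and Y': "(\<lambda>l. Y (r l)) \<longlonglongrightarrow> Y'"
    using \<open>compact S\<close> unfolding compact_def comp_def by metis
  have "Y l ** Y l = X" for l
    using R(2)[of "Suc l"] by (simp add: Y_def mult_2 flip: matrix_power_add)
  then have "Y' ** Y' = X"
    using tendsto_matrix_mult[OF Y' Y'] by (simp add: LIMSEQ_const_iff)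
  moreover have "\<exists>Z\<in>S. matrix_power Z (2 ^ h) = Y'" for h
  proof -
    \<comment> \<open>A root of order \<open>2 ^ h\<close> of \<open>Y (r l)\<close> as soon as
      \<open>h \<le> r l\<close>; the truncation of the subtraction affects finitely many
      \<open>l\<close>.\<close>
    define Z where "Z l = matrix_power (R (Suc (r l))) (2 ^ (r l - h))" for l
    have "\<And>l. Z l \<in> S" using R power by (auto simp: Z_def)
    then obtain Z' s where s: "strict_mono s" and Z': "Z' \<in> S" "(\<lambda>l. Z (s l)) \<longlonglongrightarrow> Z'"
      using \<open>compact S\<close> unfolding compact_def comp_def by metis
    have "matrix_power (Z l) (2 ^ h) = Y (r l)" if "h \<le> l" for l
    proof -
      have "h \<le> r l" using that r seq_suble le_trans by blast
      then show ?thesis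
        by (simp add: Z_def Y_def flip: matrix_power_mult power_add)
    qed
    then have "\<forall>\<^sub>F l in sequentially. matrix_power (Z (s l)) (2 ^ h) = Y (r (s l))"
      by (intro eventually_sequentiallyI[of h]) (meson s seq_suble le_trans)
    moreover have "(\<lambda>l. Y (r (s l))) \<longlonglongrightarrow> Y'"
      using LIMSEQ_subseq_LIMSEQ[OF Y' s] by (simp add: comp_def)
    ultimately have "(\<lambda>l. matrix_power (Z (s l)) (2 ^ h)) \<longlonglongrightarrow> Y'"
      by (simp add: tendsto_cong)
    moreover have "(\<lambda>l. matrix_power (Z (s l)) (2 ^ h)) \<longlonglongrightarrow> matrix_power Z' (2 ^ h)"
      by (intro tendsto_intros Z')
    ultimately show ?thesis using Z'(1) LIMSEQ_unique by blast
  qed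
  ultimately show ?thesis by blast
qed

text \<open>Dependent choice, with the existence of roots of all orders \<open>2 ^ h\<close> in
  \<open>S\<close> as invariant; the order \<open>2 ^ 0\<close> gives membership in
  \<open>S\<close>.\<close>

lemma square_root_chain_exists:
  fixes S :: "(complex^'n^'n) set"
  assumes "compact S" and "\<And>X k. X \<in> S \<Longrightarrow> matrix_power X k \<in> S"
    and "\<forall>l. \<exists>R\<in>S. matrix_power R (2 ^ l) = X"
  obtains G where "G 0 = X" "\<And>l. G l \<in> S" "\<And>l. G (Suc l) ** G (Suc l) = G l"
proof -
  have "\<exists>G. \<forall>l. ((\<forall>h. \<exists>R\<in>S. matrix_power R (2 ^ h) = G l) \<and> (l = 0 \<longrightarrow> G l = X)) \<and>
      G (Suc l) ** G (Suc l) = G l"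
    by (rule dependent_nat_choice)
      (use assms(3) infinitely_many_roots_imp_square_root[OF assms(1,2)] in auto)
  then obtain G where G: "\<forall>l. ((\<forall>h. \<exists>R\<in>S. matrix_power R (2 ^ h) = G l) \<and>
      (l = 0 \<longrightarrow> G l = X)) \<and> G (Suc l) ** G (Suc l) = G l"
    by blast
  show thesis
  proof (rule that[of G])
    show "G l \<in> S" for l
    proof -
      obtain R where "R \<in> S" "matrix_power R (2 ^ 0) = G l" using G by blast
      then show ?thesis by simp
    qed
  qed (use G in blast)+
qed

section \<open>The semigroup over the positive dyadic rationals and its closure\<close>

locale square_root_chain =
  fixes S :: "(complex^'n^'n) set" and G :: "nat \<Rightarrow> complex^'n^'n"
  assumes compact_S: "compact S"
    and power_in_S: "\<And>X k. X \<in> S \<Longrightarrow> matrix_power X k \<in> S"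
    and G_in_S: "\<And>l. G l \<in> S"
    and G_square: "\<And>l. G (Suc l) ** G (Suc l) = G l"
begin

text \<open>The graph of the semigroup \<open>T\<close>. Recording the times lets the closure be
  multivalued: several limits can lie over one time, in particular over 0.\<close>

definition dyadic_powers :: "(real \<times> (complex^'n^'n)) set" where
  "dyadic_powers = {(real k / 2 ^ l, matrix_power (G l) k) | k l. k \<ge> 1}"

definition dyadic_closure :: "(real \<times> (complex^'n^'n)) set" where
  "dyadic_closure = closure dyadic_powers"

lemma dyadic_powersI:
  "k \<ge> 1 \<Longrightarrow> t = real k / 2 ^ l \<Longrightarrow> X = matrix_power (G l) k \<Longrightarrow> (t, X) \<in> dyadic_powers"
  by (auto simp: dyadic_powers_def)

lemma G_add: "matrix_power (G (l + j)) (2 ^ j) = G l"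
proof (induction j)
  case (Suc j)
  then show ?case
    by (simp only: power_Suc matrix_power_double add_Suc_right G_square)
qed simp

lemma dyadic_powers_level:
  "(real k / 2 ^ l, matrix_power (G l) k)
    = (real (k * 2 ^ j) / 2 ^ (l + j), matrix_power (G (l + j)) (k * 2 ^ j))"
  by (simp add: power_add mult.commute[of k] matrix_power_mult G_add)

text \<open>Over a common denominator two elements are powers of one matrix, so products,
  commutation and quotients reduce to arithmetic of exponents.\<close>

lemma dyadic_powers_common_level:
  assumes "x \<in> dyadic_powers" "y \<in> dyadic_powers"
  obtains l a b where "a \<ge> 1" "b \<ge> 1" "x = (real a / 2 ^ l, matrix_power (G l) a)"
    "y = (real b / 2 ^ l, matrix_power (G l) b)"
proof -
  obtain k l k' l' where kl: "k \<ge> 1" "k' \<ge> 1" "x = (real k / 2 ^ l, matrix_power (G l) k)"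
    "y = (real k' / 2 ^ l', matrix_power (G l') k')"
    using assms unfolding dyadic_powers_def by blast
  show thesis
    by (rule that[of "k * 2 ^ l'" "k' * 2 ^ l" "l + l'"])
      (use kl dyadic_powers_level[of k l l'] dyadic_powers_level[of k' l' l] in
        \<open>simp_all add: add.commute\<close>)
qed

lemma dyadic_powers_subset_closure: "dyadic_powers \<subseteq> dyadic_closure"
  by (simp add: dyadic_closure_def closure_subset)

lemma closed_dyadic_closure: "closed dyadic_closure"
  by (simp add: dyadic_closure_def)

lemma dyadic_closure_sequence:
  assumes "(t, X) \<in> dyadic_closure"
  obtains q T where "\<And>i. (q i, T i) \<in> dyadic_powers" "q \<longlonglongrightarrow> t" "T \<longlonglongrightarrow> X"
proof -
  obtain f where f: "\<And>i. f i \<in> dyadic_powers" "f \<longlonglongrightarrow> (t, X)"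
    using assms unfolding dyadic_closure_def closure_sequential by blast
  show thesis
    by (rule that[of "\<lambda>i. fst (f i)" "\<lambda>i. snd (f i)"])
      (use f tendsto_fst[OF f(2)] tendsto_snd[OF f(2)] in auto)
qed

lemma dyadic_closure_limit:
  assumes "\<And>i. (q i, T i) \<in> dyadic_closure" "q \<longlonglongrightarrow> t" "T \<longlonglongrightarrow> X"
  shows "(t, X) \<in> dyadic_closure"
  using closed_sequentially[OF closed_dyadic_closure assms(1) tendsto_Pair[OF assms(2,3)]] .

lemma dyadic_closure_in_S: "(t, X) \<in> dyadic_closure \<Longrightarrow> X \<in> S"
proof -
  have "dyadic_powers \<subseteq> UNIV \<times> S"
    using G_in_S power_in_S by (auto simp: dyadic_powers_def)
  then have "dyadic_closure \<subseteq> UNIV \<times> S"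
    unfolding dyadic_closure_def by (rule closure_minimal) (simp add: closed_Times compact_imp_closed compact_S)
  then show "(t, X) \<in> dyadic_closure \<Longrightarrow> X \<in> S" by blast
qed

lemma dyadic_closure_mult:
  assumes "(s, X) \<in> dyadic_closure" "(t, Y) \<in> dyadic_closure"
  shows "(s + t, X ** Y) \<in> dyadic_closure"
proof -
  obtain q T where 1: "\<And>i. (q i, T i) \<in> dyadic_powers" "q \<longlonglongrightarrow> s" "T \<longlonglongrightarrow> X"
    using dyadic_closure_sequence assms(1) by metis
  obtain q' T' where 2: "\<And>i. (q' i, T' i) \<in> dyadic_powers" "q' \<longlonglongrightarrow> t" "T' \<longlonglongrightarrow> Y"
    using dyadic_closure_sequence assms(2) by metis
  have "(q i + q' i, T i ** T' i) \<in> dyadic_powers" for i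
  proof -
    obtain l a b where "a \<ge> 1" "b \<ge> 1" "(q i, T i) = (real a / 2 ^ l, matrix_power (G l) a)"
      "(q' i, T' i) = (real b / 2 ^ l, matrix_power (G l) b)"
      using dyadic_powers_common_level[OF 1(1)[of i] 2(1)[of i]] by metis
    then show ?thesis
      by (intro dyadic_powersI[of "a + b" _ l]) (simp_all add: matrix_power_add add_divide_distrib)
  qed
  then have "\<And>i. (q i + q' i, T i ** T' i) \<in> dyadic_closure"
    using dyadic_powers_subset_closure by blast
  then show ?thesis
    by (rule dyadic_closure_limit[OF _ tendsto_add[OF 1(2) 2(2)] tendsto_matrix_mult[OF 1(3) 2(3)]])
qed

lemma dyadic_closure_commute:
  assumes "(s, X) \<in> dyadic_closure" "(t, Y) \<in> dyadic_closure"
  shows "X ** Y = Y ** X"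
proof -
  obtain q T where 1: "\<And>i. (q i, T i) \<in> dyadic_powers" "q \<longlonglongrightarrow> s" "T \<longlonglongrightarrow> X"
    using dyadic_closure_sequence assms(1) by metis
  obtain q' T' where 2: "\<And>i. (q' i, T' i) \<in> dyadic_powers" "q' \<longlonglongrightarrow> t" "T' \<longlonglongrightarrow> Y"
    using dyadic_closure_sequence assms(2) by metis
  have "T i ** T' i = T' i ** T i" for i
    using dyadic_powers_common_level[OF 1(1)[of i] 2(1)[of i]]
    by (metis matrix_power_commute prod.inject)
  then show ?thesis
    using tendsto_matrix_mult[OF 1(3) 2(3)] tendsto_matrix_mult[OF 2(3) 1(3)] LIMSEQ_unique
    by auto
qed

lemma dyadic_closure_subsequence:
  assumes "\<And>i. (q i, T i) \<in> dyadic_closure" "q \<longlonglongrightarrow> t"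
  obtains r X where "strict_mono r" "(t, X) \<in> dyadic_closure" "(\<lambda>i. T (r i)) \<longlonglongrightarrow> X"
proof -
  have "\<And>i. T i \<in> S" using assms(1) dyadic_closure_in_S by blast
  then obtain X r where r: "strict_mono (r :: nat \<Rightarrow> nat)" "(\<lambda>i. T (r i)) \<longlonglongrightarrow> X"
    using compact_S unfolding compact_def comp_def by metis
  have "(t, X) \<in> dyadic_closure"
    by (rule dyadic_closure_limit[of "\<lambda>i. q (r i)" "\<lambda>i. T (r i)"])
      (use assms r LIMSEQ_subseq_LIMSEQ[OF assms(2) r(1)] in \<open>auto simp: comp_def\<close>)
  then show thesis using that r by blast
qed

text \<open>Passing from level \<open>l\<close> to \<open>Suc l\<close> with the same exponent
  halves the time and takes a square root; compactness carries this from dyadic elements to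
  limits.\<close>

lemma dyadic_closure_square_root:
  assumes "(t, X) \<in> dyadic_closure"
  obtains Y where "(t / 2, Y) \<in> dyadic_closure" "Y ** Y = X"
proof -
  obtain q T where 1: "\<And>i. (q i, T i) \<in> dyadic_powers" "q \<longlonglongrightarrow> t" "T \<longlonglongrightarrow> X"
    using dyadic_closure_sequence assms by metis
  have "\<exists>Y. (q i / 2, Y) \<in> dyadic_powers \<and> Y ** Y = T i" for i
  proof -
    obtain k l where kl: "k \<ge> 1" "q i = real k / 2 ^ l" "T i = matrix_power (G l) k"
      using 1(1)[of i] unfolding dyadic_powers_def by blast
    then have "(q i / 2, matrix_power (G (Suc l)) k) \<in> dyadic_powers"
      by (intro dyadic_powersI[of k _ "Suc l"]) simp_all
    moreover have "matrix_power (G (Suc l)) k ** matrix_power (G (Suc l)) k = T i"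
      using matrix_power_mult_distrib[of "G (Suc l)" "G (Suc l)" k] kl(3) by (simp add: G_square)
    ultimately show ?thesis by blast
  qed
  then obtain R where "\<And>i. (q i / 2, R i) \<in> dyadic_powers" and R2: "\<And>i. R i ** R i = T i"
    by metis
  then have R: "\<And>i. (q i / 2, R i) \<in> dyadic_closure"
    using dyadic_powers_subset_closure by blast
  have "(\<lambda>i. q i / 2) \<longlonglongrightarrow> t / 2"
    using tendsto_divide[OF 1(2) tendsto_const, of 2] by simp
  then obtain r Y where r: "strict_mono r" "(t / 2, Y) \<in> dyadic_closure" "(\<lambda>i. R (r i)) \<longlonglongrightarrow> Y"
    by (rule dyadic_closure_subsequence[OF R])
  have "(\<lambda>i. T (r i)) \<longlonglongrightarrow> Y ** Y"
    using tendsto_matrix_mult[OF r(3) r(3)] by (simp add: R2)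
  moreover have "(\<lambda>i. T (r i)) \<longlonglongrightarrow> X"
    using LIMSEQ_subseq_LIMSEQ[OF 1(3) r(1)] by (simp add: comp_def)
  ultimately have "Y ** Y = X" using LIMSEQ_unique by blast
  then show thesis using that r(2) by simp
qed

section \<open>The limit group over time 0\<close>

text \<open>This yields inverses over time 0. An approximant of \<open>X\<close> at a small time
  divides a dyadic \<open>W\<close> at a later time, by subtraction of exponents, and the quotients
  accumulate over the time of \<open>W\<close>. A second limit replaces \<open>W\<close> by
  \<open>Z\<close>.\<close>

lemma dyadic_closure_zero_divides:
  assumes X: "(0, X) \<in> dyadic_closure" and Z: "(t, Z) \<in> dyadic_closure"
  obtains Y where "(t, Y) \<in> dyadic_closure" "X ** Y = Z"
proof -
  obtain q T where 1: "\<And>i. (q i, T i) \<in> dyadic_powers" "q \<longlonglongrightarrow> 0" "T \<longlonglongrightarrow> X"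
    using dyadic_closure_sequence X by metis
  have dyadic: "\<exists>Y. (u, Y) \<in> dyadic_closure \<and> X ** Y = W" if "(u, W) \<in> dyadic_powers" for u W
  proof -
    \<comment> \<open>A dyadic time is positive, so all but finitely many approximants come before
      \<open>u\<close>; this makes the exponent \<open>b - a\<close> positive.\<close>
    have "u > 0" using that by (auto simp: dyadic_powers_def)
    then have "\<forall>\<^sub>F i in sequentially. q i < u" using 1(2) by (simp add: order_tendsto_iff)
    then obtain N where N: "\<And>i. i \<ge> N \<Longrightarrow> q i < u" unfolding eventually_sequentially by blast
    have "\<exists>R. (u - q (i + N), R) \<in> dyadic_powers \<and> T (i + N) ** R = W" for i
    proof -
      obtain l a b where "a \<ge> 1" "b \<ge> 1"
        "(q (i + N), T (i + N)) = (real a / 2 ^ l, matrix_power (G l) a)"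
        "(u, W) = (real b / 2 ^ l, matrix_power (G l) b)"
        using dyadic_powers_common_level[OF 1(1)[of "i + N"] \<open>(u, W) \<in> dyadic_powers\<close>]
        by metis
      then have l: "q (i + N) = real a / 2 ^ l" "T (i + N) = matrix_power (G l) a"
        "u = real b / 2 ^ l" "W = matrix_power (G l) b" by auto
      have "a < b" using N[of "i + N"] l by (simp add: divide_less_cancel)
      then have "u - q (i + N) = real (b - a) / 2 ^ l" and "b - a \<ge> 1"
        and "T (i + N) ** matrix_power (G l) (b - a) = W"
        using l by (simp_all add: diff_divide_distrib of_nat_diff flip: matrix_power_add)
      then show ?thesis unfolding dyadic_powers_def by blast
    qed
    then obtain R where "\<And>i. (u - q (i + N), R i) \<in> dyadic_powers"
      and R2: "\<And>i. T (i + N) ** R i = W"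
      by metis
    then have R: "\<And>i. (u - q (i + N), R i) \<in> dyadic_closure"
      using dyadic_powers_subset_closure by blast
    have "(\<lambda>i. u - q (i + N)) \<longlonglongrightarrow> u"
      using tendsto_diff[OF tendsto_const LIMSEQ_ignore_initial_segment[OF 1(2)], of u] by simp
    then obtain r Y where r: "strict_mono r" "(u, Y) \<in> dyadic_closure" "(\<lambda>i. R (r i)) \<longlonglongrightarrow> Y"
      by (rule dyadic_closure_subsequence[OF R])
    have "(\<lambda>i. T (r i + N)) \<longlonglongrightarrow> X"
      using LIMSEQ_subseq_LIMSEQ[OF LIMSEQ_ignore_initial_segment[OF 1(3)] r(1)]
      by (simp add: comp_def)
    from tendsto_matrix_mult[OF this r(3)] have "X ** Y = W"
      by (simp add: R2 LIMSEQ_const_iff)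
    then show ?thesis using r by blast
  qed
  obtain p U where 2: "\<And>i. (p i, U i) \<in> dyadic_powers" "p \<longlonglongrightarrow> t" "U \<longlonglongrightarrow> Z"
    using dyadic_closure_sequence Z by metis
  obtain R where R: "\<And>i. (p i, R i) \<in> dyadic_closure" "\<And>i. X ** R i = U i"
    using dyadic[OF 2(1)] by metis
  obtain r Y where r: "strict_mono r" "(t, Y) \<in> dyadic_closure" "(\<lambda>i. R (r i)) \<longlonglongrightarrow> Y"
    using dyadic_closure_subsequence[OF R(1) 2(2)] .
  have "(\<lambda>i. U (r i)) \<longlonglongrightarrow> X ** Y"
    using tendsto_matrix_mult[OF tendsto_const r(3)] by (simp add: R flip: R(2))
  moreover have "(\<lambda>i. U (r i)) \<longlonglongrightarrow> Z"
    using LIMSEQ_subseq_LIMSEQ[OF 2(3) r(1)] by (simp add: comp_def)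
  ultimately have "X ** Y = Z" using LIMSEQ_unique by blast
  then show thesis using that r by blast
qed

text \<open>Some \<open>X\<close> over time 0 divides itself, which gives \<open>Q\<close> with
  \<open>X ** Q = X\<close>. As \<open>X\<close> divides every \<open>Z\<close>, commutativity makes
  \<open>Q\<close> fix every \<open>Z\<close>.\<close>

lemma dyadic_closure_identity:
  obtains Q where "(0, Q) \<in> dyadic_closure" "\<And>t Z. (t, Z) \<in> dyadic_closure \<Longrightarrow> Q ** Z = Z"
proof -
  have "(1 / 2 ^ l, G l) \<in> dyadic_closure" for l
    using dyadic_powers_subset_closure dyadic_powersI[of 1 "1 / 2 ^ l" l "G l"] by (simp add: subset_iff)
  moreover have "(\<lambda>l. 1 / 2 ^ l :: real) \<longlonglongrightarrow> 0"
    using LIMSEQ_power_zero[of "1/2::real"] by (simp add: power_divide)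
  ultimately obtain X where X: "(0, X) \<in> dyadic_closure"
    using dyadic_closure_subsequence by metis
  obtain Q where Q: "(0, Q) \<in> dyadic_closure" "X ** Q = X"
    using dyadic_closure_zero_divides[OF X X] by metis
  have "Q ** Z = Z" if Z: "(t, Z) \<in> dyadic_closure" for t Z
  proof -
    obtain Y where "(t, Y) \<in> dyadic_closure" "X ** Y = Z" using dyadic_closure_zero_divides[OF X Z] by metis
    then show ?thesis using Q dyadic_closure_commute[OF X Q(1)] by (metis matrix_mul_assoc)
  qed
  then show thesis using that Q by blast
qed

lemma dyadic_closure_nonneg: "(t, X) \<in> dyadic_closure \<Longrightarrow> 0 \<le> t"
proof -
  have "dyadic_powers \<subseteq> {0..} \<times> UNIV" by (auto simp: dyadic_powers_def)
  then have "dyadic_closure \<subseteq> {0..} \<times> UNIV"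
    unfolding dyadic_closure_def by (rule closure_minimal) (simp add: closed_Times)
  then show "(t, X) \<in> dyadic_closure \<Longrightarrow> 0 \<le> t" by auto
qed

section \<open>Square roots close to the identity of the limit group\<close>

text \<open>Otherwise there are counterexamples \<open>X i\<close> tending to \<open>Q\<close> at
  times tending to 0. Their square roots \<open>Y i\<close> accumulate at some \<open>J\<close> over
  time 0 with \<open>J ** J = Q\<close>, possibly different from \<open>Q\<close>. But
  \<open>Y i ** J\<close> is also a root of \<open>X i\<close> at the same time, and it tends to
  \<open>J ** J = Q\<close> along the subsequence.\<close>

lemma dyadic_closure_square_root_near_identity:
  assumes Q: "(0, Q) \<in> dyadic_closure" and QZ: "\<And>t Z. (t, Z) \<in> dyadic_closure \<Longrightarrow> Q ** Z = Z"
    and "0 < \<epsilon>"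
  shows "\<exists>\<delta>>0. \<forall>t X. (t, X) \<in> dyadic_closure \<longrightarrow> t < \<delta> \<longrightarrow> norm (X - Q) < \<delta> \<longrightarrow>
    (\<exists>Y. (t / 2, Y) \<in> dyadic_closure \<and> Y ** Y = X \<and> norm (Y - Q) < \<epsilon>)"
proof (rule ccontr)
  assume neg: "\<not> ?thesis"
  have "\<exists>t X. (t, X) \<in> dyadic_closure \<and> t < \<delta> \<and> norm (X - Q) < \<delta> \<and>
      (\<forall>Y. (t / 2, Y) \<in> dyadic_closure \<longrightarrow> Y ** Y = X \<longrightarrow> \<not> norm (Y - Q) < \<epsilon>)" if "0 < \<delta>" for \<delta>
    using neg that by blast
  then have "\<exists>t X. (t, X) \<in> dyadic_closure \<and> t < inverse (real (Suc i)) \<and> norm (X - Q) < inverse (real (Suc i)) \<and>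
      (\<forall>Y. (t / 2, Y) \<in> dyadic_closure \<longrightarrow> Y ** Y = X \<longrightarrow> \<not> norm (Y - Q) < \<epsilon>)" for i
    by simp
  then obtain t X where tX: "\<And>i. (t i, X i) \<in> dyadic_closure" "\<And>i. t i < inverse (real (Suc i))"
      "\<And>i. norm (X i - Q) < inverse (real (Suc i))"
    and no_root: "\<And>i Y. (t i / 2, Y) \<in> dyadic_closure \<Longrightarrow> Y ** Y = X i \<Longrightarrow> \<not> norm (Y - Q) < \<epsilon>"
    by metis
  have t: "t \<longlonglongrightarrow> 0"
    by (rule tendsto_sandwich[OF _ _ tendsto_const LIMSEQ_inverse_real_of_nat])
      (use dyadic_closure_nonneg[OF tX(1)] tX(2) in \<open>auto intro!: always_eventually less_imp_le\<close>)
  have "(\<lambda>i. norm (X i - Q)) \<longlonglongrightarrow> 0"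
    by (rule tendsto_sandwich[OF _ _ tendsto_const LIMSEQ_inverse_real_of_nat])
      (use tX(3) in \<open>auto intro!: always_eventually less_imp_le\<close>)
  then have X: "X \<longlonglongrightarrow> Q"
    using LIM_zero_iff tendsto_norm_zero_iff by blast
  have "\<exists>Y. (t i / 2, Y) \<in> dyadic_closure \<and> Y ** Y = X i" for i
    using dyadic_closure_square_root[OF tX(1)] by metis
  then obtain Y where Y: "\<And>i. (t i / 2, Y i) \<in> dyadic_closure" and Y2: "\<And>i. Y i ** Y i = X i"
    by metis
  have "(\<lambda>i. t i / 2) \<longlonglongrightarrow> 0"
    using tendsto_divide[OF t tendsto_const, of 2] by simp
  then obtain r J where r: "strict_mono r" "(0, J) \<in> dyadic_closure" "(\<lambda>i. Y (r i)) \<longlonglongrightarrow> J"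
    by (rule dyadic_closure_subsequence[OF Y])
  have "(\<lambda>i. X (r i)) \<longlonglongrightarrow> J ** J"
    using tendsto_matrix_mult[OF r(3) r(3)] by (simp add: Y2)
  moreover have "(\<lambda>i. X (r i)) \<longlonglongrightarrow> Q"
    using LIMSEQ_subseq_LIMSEQ[OF X r(1)] by (simp add: comp_def)
  ultimately have J: "J ** J = Q" using LIMSEQ_unique by blast
  then have "(\<lambda>i. Y (r i) ** J) \<longlonglongrightarrow> Q"
    using tendsto_matrix_mult[OF r(3) tendsto_const, of J] by simp
  then obtain i where i: "norm (Y (r i) ** J - Q) < \<epsilon>"
    by (meson LIMSEQ_D \<open>0 < \<epsilon>\<close> order_refl)
  have YJ: "(t (r i) / 2, Y (r i) ** J) \<in> dyadic_closure"
    using dyadic_closure_mult[OF Y r(2)] by simp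
  have "(Y (r i) ** J) ** (Y (r i) ** J) = (Y (r i) ** Y (r i)) ** (J ** J)"
    using dyadic_closure_commute[OF Y r(2)] by (metis matrix_mul_assoc)
  also have "\<dots> = X (r i)"
    using dyadic_closure_commute[OF Q tX(1)] QZ[OF tX(1)] by (simp add: J Y2)
  finally show False using no_root[OF YJ] i by blast
qed

text \<open>The chain restarts at a dyadic element \<open>T i\<close> close to \<open>Q\<close>, at
  time \<open>c / 2 ^ m\<close>, with all roots chosen near \<open>Q\<close>; the
  \<open>2 ^ m\<close>-th powers of its members serve as \<open>H\<close>.\<close>

lemma convergent_roots:
  obtains c H Q where "c \<ge> 1" "\<And>j. H j \<in> S" "\<And>j. matrix_power (H j) (2 ^ j) = matrix_power (G 0) c"
    "\<And>n l. (\<forall>k. 1 \<le> n k) \<Longrightarrow> (\<lambda>k. real (n k) / 2 ^ l k) \<longlonglongrightarrow> 0 \<Longrightarrow>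
      (\<lambda>k. matrix_power (H (l k)) (n k)) \<longlonglongrightarrow> Q"
proof -
  obtain Q where Q: "(0, Q) \<in> dyadic_closure" and QZ: "\<And>t Z. (t, Z) \<in> dyadic_closure \<Longrightarrow> Q ** Z = Z"
    using dyadic_closure_identity by metis
  have ZQ: "(t, Z) \<in> dyadic_closure \<Longrightarrow> Z ** Q = Z" for t Z
    using dyadic_closure_commute[OF Q] QZ by metis
  obtain C where "0 < C" and C: "\<And>(A :: complex^'n^'n) (B :: complex^'n^'n). norm (A ** B) \<le> norm A * norm B * C"
    using bounded_bilinear.pos_bounded[OF bounded_bilinear_matrix_mult] by metis
  \<comment> \<open>This radius keeps the quadratic term \<open>(Y - Q) ** (Y - Q)\<close> within
    half of \<open>norm (Y - Q)\<close>.\<close>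
  then have "0 < 1 / (2 * C)" by simp
  then have "\<exists>\<delta>>0. \<forall>t X. (t, X) \<in> dyadic_closure \<longrightarrow> t < \<delta> \<longrightarrow> norm (X - Q) < \<delta> \<longrightarrow>
      (\<exists>Y. (t / 2, Y) \<in> dyadic_closure \<and> Y ** Y = X \<and> norm (Y - Q) < 1 / (2 * C))"
    by (rule dyadic_closure_square_root_near_identity[OF Q, rotated]) (rule QZ)
  then obtain \<delta>0 where "0 < \<delta>0" and root: "\<And>t X. (t, X) \<in> dyadic_closure \<Longrightarrow> t < \<delta>0 \<Longrightarrow> norm (X - Q) < \<delta>0 \<Longrightarrow>
      \<exists>Y. (t / 2, Y) \<in> dyadic_closure \<and> Y ** Y = X \<and> norm (Y - Q) < 1 / (2 * C)"
    by blast
  \<comment> \<open>Radius \<open>\<delta>0\<close> allows a further root to be taken;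
    \<open>1 / (6 * C)\<close> is the smallness required by the bound on powers.\<close>
  define \<delta> where "\<delta> = min \<delta>0 (1 / (6 * C))"
  have "0 < \<delta>" "\<delta> \<le> \<delta>0" using \<open>0 < C\<close> \<open>0 < \<delta>0\<close> by (auto simp: \<delta>_def)
  have "6 * \<delta> * C \<le> 6 * (1 / (6 * C)) * C"
    using \<open>0 < C\<close> by (intro mult_right_mono mult_left_mono) (auto simp: \<delta>_def)
  then have \<delta>C: "6 * \<delta> * C \<le> 1" using \<open>0 < C\<close> by simp
  have root': "\<exists>Y. (t / 2, Y) \<in> dyadic_closure \<and> Y ** Y = X \<and> norm (Y - Q) \<le> 2 / 3 * norm (X - Q)"
    if X: "(t, X) \<in> dyadic_closure" "t < \<delta>0" "norm (X - Q) < \<delta>0" for t X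
  proof -
    obtain Y where Y: "(t / 2, Y) \<in> dyadic_closure" "Y ** Y = X" "norm (Y - Q) < 1 / (2 * C)"
      using root[OF X] by blast
    \<comment> \<open>Squaring is doubling up to the quadratic term, so
      \<open>3 / 2 * norm (Y - Q) \<le> norm (X - Q)\<close>, whence the contraction factor
      2/3.\<close>
    have "X - Q = 2 *\<^sub>R (Y - Q) + (Y - Q) ** (Y - Q)"
      using QZ[OF Y(1)] ZQ[OF Y(1)] QZ[OF Q] Y(2)
      by (simp add: scaleR_2 bounded_bilinear.diff_left[OF bounded_bilinear_matrix_mult]
          bounded_bilinear.diff_right[OF bounded_bilinear_matrix_mult])
    then have "2 *\<^sub>R (Y - Q) = (X - Q) - (Y - Q) ** (Y - Q)" by simp
    then have "norm (2 *\<^sub>R (Y - Q)) \<le> norm (X - Q) + norm ((Y - Q) ** (Y - Q))"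
      by (simp only: norm_triangle_ineq4)
    moreover have "norm (Y - Q) * (norm (Y - Q) * C) \<le> norm (Y - Q) * (1 / 2)"
      using Y(3) \<open>0 < C\<close> by (intro mult_left_mono) (auto simp: field_simps)
    ultimately have "2 * norm (Y - Q) \<le> norm (X - Q) + norm (Y - Q) * (1 / 2)"
      using C[of "Y - Q" "Y - Q"] by (simp add: mult.assoc)
    then have "norm (Y - Q) \<le> 2 / 3 * norm (X - Q)" by linarith
    then show ?thesis using Y by blast
  qed
  obtain q T where qT: "\<And>i. (q i, T i) \<in> dyadic_powers" "q \<longlonglongrightarrow> 0" "T \<longlonglongrightarrow> Q"
    using dyadic_closure_sequence[OF Q] by metis
  have "\<forall>\<^sub>F i in sequentially. q i < \<delta> \<and> norm (T i - Q) < \<delta>"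
    using order_tendstoD(2)[OF qT(2) \<open>0 < \<delta>\<close>] tendstoD[OF qT(3) \<open>0 < \<delta>\<close>]
    by eventually_elim (simp add: dist_norm)
  then obtain i where i: "q i < \<delta>" "norm (T i - Q) < \<delta>"
    unfolding eventually_sequentially by blast
  obtain c m where cm: "c \<ge> 1" "q i = real c / 2 ^ m" "T i = matrix_power (G m) c"
    using qT(1)[of i] unfolding dyadic_powers_def by blast
  \<comment> \<open>The decay feeds the bound on powers, the strict bounds by
    \<open>\<delta>\<close> on time and distance permit the next root, and the last conjunct anchors
    the chain.\<close>
  define P where "P j X \<longleftrightarrow> (\<exists>t. (t, X) \<in> dyadic_closure \<and> t < \<delta>) \<and> norm (X - Q) \<le> \<delta> * (2 / 3) ^ j \<and>
      norm (X - Q) < \<delta> \<and> (j = 0 \<longrightarrow> X = T i)" for j X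
  have "\<exists>X. \<forall>j. P j (X j) \<and> X (Suc j) ** X (Suc j) = X j"
  proof (rule dependent_nat_choice)
    show "\<exists>X. P 0 X"
      using i qT(1)[of i] dyadic_powers_subset_closure by (auto simp: P_def intro: less_imp_le)
  next
    fix X j
    assume "P j X"
    then obtain t where t: "(t, X) \<in> dyadic_closure" "t < \<delta>" "norm (X - Q) \<le> \<delta> * (2 / 3) ^ j" "norm (X - Q) < \<delta>"
      by (auto simp: P_def)
    have "t < \<delta>0" "norm (X - Q) < \<delta>0" using t(2,4) \<open>\<delta> \<le> \<delta>0\<close> by linarith+
    then obtain Y where Y: "(t / 2, Y) \<in> dyadic_closure" "Y ** Y = X" "norm (Y - Q) \<le> 2 / 3 * norm (X - Q)"
      using root'[OF t(1)] by blast
    moreover have "t / 2 < \<delta>" using t(2) \<open>0 < \<delta>\<close> by linarith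
    moreover have "norm (Y - Q) < \<delta>" using Y(3) t(4) norm_ge_zero[of "X - Q"] by linarith
    moreover have "norm (Y - Q) \<le> \<delta> * (2 / 3) ^ Suc j" using Y(3) t(3) by simp
    ultimately show "\<exists>Y. P (Suc j) Y \<and> Y ** Y = X"
      unfolding P_def by blast
  qed
  then obtain X where P: "\<And>j. P j (X j)" and X2: "\<And>j. X (Suc j) ** X (Suc j) = X j"
    by blast
  have X0: "X 0 = T i" and XL: "\<And>j. \<exists>t. (t, X j) \<in> dyadic_closure"
    and Xb: "\<And>j. norm (X j - Q) \<le> \<delta> * (2 / 3) ^ j"
    using P unfolding P_def by blast+
  have X_root: "matrix_power (X j) (2 ^ j) = X 0" for j
    by (induction j) (simp_all only: power_0 power_Suc matrix_power_double X2, simp)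
  \<comment> \<open>Since \<open>X 0\<close> has time \<open>c / 2 ^ m\<close>, its
    \<open>2 ^ m\<close>-th power clears the denominator and is the \<open>c\<close>-th power of
    \<open>G 0\<close>.\<close>
  have "matrix_power (matrix_power (X j) (2 ^ m)) (2 ^ j) = matrix_power (G 0) c" for j
  proof -
    have "matrix_power (matrix_power (X j) (2 ^ m)) (2 ^ j) = matrix_power (X 0) (2 ^ m)"
      by (simp add: mult.commute flip: matrix_power_mult X_root[of j])
    also have "\<dots> = matrix_power (matrix_power (G m) (2 ^ m)) c"
      by (simp add: X0 cm mult.commute flip: matrix_power_mult)
    finally show ?thesis using G_add[of 0 m] by simp
  qed
  moreover have "matrix_power (X j) (2 ^ m) \<in> S" for j
    using XL dyadic_closure_in_S power_in_S by blast
  moreover have "(\<lambda>k. matrix_power (matrix_power (X (l k)) (2 ^ m)) (n k)) \<longlonglongrightarrow> Q"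
    if n: "\<forall>k. 1 \<le> n k" "(\<lambda>k. real (n k) / 2 ^ l k) \<longlonglongrightarrow> 0" for n l
  proof -
    have "(\<lambda>k. matrix_power (X (l k)) (2 ^ m * n k)) \<longlonglongrightarrow> Q"
    proof (rule square_root_chain_power_tendsto[OF C _ _ _ X2 Xb _ \<delta>C])
      show "Q ** Q = Q" "Q ** X j = X j" "X j ** Q = X j" for j
        using QZ ZQ Q XL by blast+
      show "1 \<le> 2 ^ m * n k" for k using n(1) by (simp add: Suc_le_eq)
      show "(\<lambda>k. real (2 ^ m * n k) / 2 ^ l k) \<longlonglongrightarrow> 0"
        using tendsto_mult[OF tendsto_const n(2), of "2 ^ m"] by simp
    qed (use \<open>0 < C\<close> in simp)
    then show ?thesis by (simp add: matrix_power_mult)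
  qed
  ultimately show thesis using that[of c "\<lambda>j. matrix_power (X j) (2 ^ m)" Q] cm(1) by blast
qed

end

subsection \<open>Compactness of the set of quantum channels\<close>

lemma superop_mat_1 [simp]:
  fixes X :: "complex^('n::finite)^'n"
  shows "superop (mat 1) X = X"
proof -
  have "(\<Sum>y\<in>UNIV. (mat 1 :: complex^('n \<times> 'n)^('n \<times> 'n)) $ (a, b) $ y * X $ fst y $ snd y)
      = (\<Sum>y\<in>UNIV. if y = (a, b) then X $ a $ b else 0)" for a b
    by (rule sum.cong) (auto simp: mat_def)
  then show ?thesis by (simp add: superop_def vec_eq_iff)
qed

lemma quantum_channel_mat_1: "quantum_channel (mat 1)"
  by (simp add: quantum_channel_def completely_positive_def trace_preserving_def)

lemma quantum_channel_mult: "quantum_channel E \<Longrightarrow> quantum_channel F \<Longrightarrow> quantum_channel (E ** F)"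
  by (simp add: quantum_channel_def completely_positive_def trace_preserving_def superop_mult)

lemma quantum_channel_matrix_power: "quantum_channel E \<Longrightarrow> quantum_channel (matrix_power E k)"
  by (induction k) (simp_all add: quantum_channel_mat_1 quantum_channel_mult)

lemma tendsto_superop_nth [tendsto_intros]:
  "(E \<longlongrightarrow> E') F \<Longrightarrow> ((\<lambda>x. superop (E x) X $ a $ b) \<longlongrightarrow> superop E' X $ a $ b) F"
  unfolding superop_def by (simp, intro tendsto_intros)

text \<open>Both conditions are tested by quadratic forms and traces that are continuous in the
  entries, and the nonnegative reals are closed.\<close>

lemma closed_quantum_channels: "closed {E :: complex^('n::finite \<times> 'n)^('n \<times> 'n). quantum_channel E}"
  unfolding closed_sequential_limits
proof (intro allI impI, elim conjE)
  fix E :: "nat \<Rightarrow> complex^('n \<times> 'n)^('n \<times> 'n)" and E'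
  assume channel: "\<forall>n. E n \<in> {E. quantum_channel E}" and lim: "E \<longlonglongrightarrow> E'"
  have "psd_block k (\<lambda>p q. superop E' (X p q))" if "psd_block k X" for k and X :: "nat \<Rightarrow> nat \<Rightarrow> complex^'n^'n"
    unfolding psd_block_def
  proof
    fix v :: "nat \<Rightarrow> complex^'n"
    have "(\<Sum>p<k. \<Sum>q<k. \<Sum>a\<in>UNIV. \<Sum>b\<in>UNIV.
        cnj (v p $ a) * superop (E n) (X p q) $ a $ b * v q $ b) \<in> \<real>\<^sub>\<ge>\<^sub>0" for n
      using channel that unfolding quantum_channel_def completely_positive_def psd_block_def by blast
    moreover have "(\<lambda>n. \<Sum>p<k. \<Sum>q<k. \<Sum>a\<in>UNIV. \<Sum>b\<in>UNIV.
        cnj (v p $ a) * superop (E n) (X p q) $ a $ b * v q $ b) \<longlonglongrightarrow>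
        (\<Sum>p<k. \<Sum>q<k. \<Sum>a\<in>UNIV. \<Sum>b\<in>UNIV.
        cnj (v p $ a) * superop E' (X p q) $ a $ b * v q $ b)"
      by (intro tendsto_intros lim)
    ultimately show "(\<Sum>p<k. \<Sum>q<k. \<Sum>a\<in>UNIV. \<Sum>b\<in>UNIV.
        cnj (v p $ a) * superop E' (X p q) $ a $ b * v q $ b) \<in> \<real>\<^sub>\<ge>\<^sub>0"
      by (rule closed_sequentially[OF closed_nonneg_Reals_complex])
  qed
  moreover have "trace (superop E' X) = trace X" for X
  proof -
    have "(\<lambda>n. trace (superop (E n) X)) \<longlonglongrightarrow> trace (superop E' X)"
      unfolding trace_def by (intro tendsto_intros lim)
    moreover have "trace (superop (E n) X) = trace X" for n
      using channel by (simp add: quantum_channel_def trace_preserving_def)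
    ultimately show ?thesis by (simp add: LIMSEQ_const_iff)
  qed
  ultimately show "E' \<in> {E. quantum_channel E}"
    by (simp add: quantum_channel_def completely_positive_def trace_preserving_def)
qed

section \<open>Bounds on the entries of a channel\<close>

definition unit_matrix :: "'n \<Rightarrow> 'n \<Rightarrow> complex^'n^'n" where
  "unit_matrix c d = (\<chi> a b. if a = c \<and> b = d then 1 else 0)"

lemma superop_unit_matrix: "superop E (unit_matrix c d) $ a $ b = E $ (a, b) $ (c, d)"
proof -
  have "superop E (unit_matrix c d) $ a $ b = (\<Sum>y\<in>UNIV. if y = (c, d) then E $ (a, b) $ (c, d) else 0)"
    unfolding superop_def vec_lambda_beta
    by (rule sum.cong) (auto simp: unit_matrix_def)
  then show ?thesis by simp
qed

text \<open>The block matrix is the product of a vector with its adjoint, so its quadratic form is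
  \<open>cnj w * w\<close>.\<close>

lemma psd_block_unit_matrix:
  fixes f :: "nat \<Rightarrow> 'n::finite"
  shows "psd_block k (\<lambda>p q. unit_matrix (f p) (f q))"
  unfolding psd_block_def
proof
  fix v :: "nat \<Rightarrow> complex^'n"
  define w where "w = (\<Sum>q<k. v q $ f q)"
  have "(\<Sum>a\<in>UNIV. \<Sum>b\<in>UNIV. cnj (v p $ a) * unit_matrix (f p) (f q) $ a $ b * v q $ b)
      = (\<Sum>a\<in>UNIV. \<Sum>b\<in>UNIV. if b = f q then if a = f p then cnj (v p $ f p) * v q $ f q else 0 else 0)" for p q
    by (intro sum.cong) (auto simp: unit_matrix_def)
  then have "(\<Sum>p<k. \<Sum>q<k. \<Sum>a\<in>UNIV. \<Sum>b\<in>UNIV. cnj (v p $ a) * unit_matrix (f p) (f q) $ a $ b * v q $ b)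
      = cnj w * w"
    by (simp add: w_def sum_product)
  also have "\<dots> = complex_of_real ((cmod w)\<^sup>2)"
    by (metis complex_norm_square mult.commute)
  finally show "(\<Sum>p<k. \<Sum>q<k. \<Sum>a\<in>UNIV. \<Sum>b\<in>UNIV.
      cnj (v p $ a) * unit_matrix (f p) (f q) $ a $ b * v q $ b) \<in> \<real>\<^sub>\<ge>\<^sub>0"
    by simp
qed

text \<open>
  The image of the positive block matrix with blocks \<open>|c\<rangle>\<langle>c|, |c\<rangle>\<langle>d|, |d\<rangle>\<langle>c|, |d\<rangle>\<langle>d|\<close>, tested on the
  vector with entry \<open>x\<close> at \<open>a\<close> in the first block and \<open>y\<close> at \<open>b\<close> in the second.
\<close>

lemma completely_positive_two_block:
  fixes E :: "complex^('n::finite \<times> 'n)^('n \<times> 'n)"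
  assumes "completely_positive E"
  shows "cnj x * E $ (a, a) $ (c, c) * x + cnj x * E $ (a, b) $ (c, d) * y
    + cnj y * E $ (b, a) $ (d, c) * x + cnj y * E $ (b, b) $ (d, d) * y \<in> \<real>\<^sub>\<ge>\<^sub>0"
proof -
  define f where "f p = (if p = 0 then c else d)" for p :: nat
  define g where "g p = (if p = 0 then a else b)" for p :: nat
  define z where "z p = (if p = 0 then x else y)" for p :: nat
  define v where "v p = (\<chi> i. if i = g p then z p else 0)" for p
  have "psd_block 2 (\<lambda>p q. superop E (unit_matrix (f p) (f q)))"
    using assms psd_block_unit_matrix unfolding completely_positive_def by blast
  then have "(\<Sum>p<2. \<Sum>q<2. \<Sum>a\<in>UNIV. \<Sum>b\<in>UNIV.
      cnj (v p $ a) * E $ (a, b) $ (f p, f q) * v q $ b) \<in> \<real>\<^sub>\<ge>\<^sub>0"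
    unfolding psd_block_def superop_unit_matrix by blast
  moreover have "(\<Sum>a\<in>UNIV. \<Sum>b\<in>UNIV. cnj (v p $ a) * E $ (a, b) $ (f p, f q) * v q $ b)
      = cnj (z p) * E $ (g p, g q) $ (f p, f q) * z q" for p q
  proof -
    have "(\<Sum>a\<in>UNIV. \<Sum>b\<in>UNIV. cnj (v p $ a) * E $ (a, b) $ (f p, f q) * v q $ b)
      = (\<Sum>a\<in>UNIV. \<Sum>b\<in>UNIV. if b = g q then if a = g p then
          cnj (z p) * E $ (g p, g q) $ (f p, f q) * z q else 0 else 0)"
      by (intro sum.cong) (auto simp: v_def)
    then show ?thesis by simp
  qed
  ultimately have "(\<Sum>p<2. \<Sum>q<2. cnj (z p) * E $ (g p, g q) $ (f p, f q) * z q) \<in> \<real>\<^sub>\<ge>\<^sub>0"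
    by simp
  then show ?thesis
    by (simp add: numeral_2_eq_2 f_def g_def z_def add.assoc)
qed

text \<open>Trace preservation on \<open>unit_matrix k k\<close> makes the nonnegative entries
  \<open>E $ (i, i) $ (k, k)\<close> sum to 1 over \<open>i\<close>; positivity of the two-block
  form then controls the other entries by these.\<close>

lemma quantum_channel_entry_le:
  fixes E :: "complex^('n::finite \<times> 'n)^('n \<times> 'n)"
  assumes "quantum_channel E"
  shows "cmod (E $ (a, b) $ (c, d)) \<le> 2"
proof -
  have cp: "completely_positive E" and tp: "trace_preserving E"
    using assms by (auto simp: quantum_channel_def)
  have diag: "0 \<le> Re (E $ (i, i) $ (k, k))" "Im (E $ (i, i) $ (k, k)) = 0" for i k
    using completely_positive_two_block[OF cp, of 1 i k i k 0] by (auto simp: complex_nonneg_Reals_iff)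
  have diag_le: "Re (E $ (i, i) $ (k, k)) \<le> 1" for i k
  proof -
    have "trace (superop E (unit_matrix k k)) = trace (unit_matrix k k :: complex^'n^'n)"
      using tp by (simp add: trace_preserving_def)
    then have "(\<Sum>j\<in>UNIV. E $ (j, j) $ (k, k)) = 1"
      by (simp add: trace_def superop_unit_matrix) (simp add: unit_matrix_def)
    then have "(\<Sum>j\<in>UNIV. Re (E $ (j, j) $ (k, k))) = 1"
      by (metis Re_sum one_complex.sel(1))
    then show ?thesis
      using member_le_sum[of i UNIV "\<lambda>j. Re (E $ (j, j) $ (k, k))"] diag by simp
  qed
  define s where "s = E $ (a, a) $ (c, c) + E $ (b, b) $ (d, d)"
  define \<alpha> where "\<alpha> = E $ (a, b) $ (c, d)"
  define \<beta> where "\<beta> = E $ (b, a) $ (d, c)"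
  have s: "Re s \<le> 2" "Im s = 0"
    using diag_le[of a c] diag_le[of b d] diag by (auto simp: s_def)
  \<comment> \<open>These are the four phases of the second component. The imaginary parts give
    \<open>\<beta> = cnj \<alpha>\<close>; the real parts then bound \<open>Re \<alpha>\<close> and
    \<open>Im \<alpha>\<close> by 1.\<close>
  have "s + \<alpha> + \<beta> \<in> \<real>\<^sub>\<ge>\<^sub>0" "s - \<alpha> - \<beta> \<in> \<real>\<^sub>\<ge>\<^sub>0"
    "s + \<i> * \<alpha> - \<i> * \<beta> \<in> \<real>\<^sub>\<ge>\<^sub>0" "s - \<i> * \<alpha> + \<i> * \<beta> \<in> \<real>\<^sub>\<ge>\<^sub>0"
    using completely_positive_two_block[OF cp, of 1 a c b d 1]
      completely_positive_two_block[OF cp, of 1 a c b d "- 1"]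
      completely_positive_two_block[OF cp, of 1 a c b d \<i>]
      completely_positive_two_block[OF cp, of 1 a c b d "- \<i>"]
    by (simp_all add: s_def \<alpha>_def \<beta>_def algebra_simps)
  then have "\<bar>Re \<alpha> + Re \<beta>\<bar> \<le> 2" "Im \<alpha> + Im \<beta> = 0" "\<bar>Im \<alpha> - Im \<beta>\<bar> \<le> 2" "Re \<alpha> = Re \<beta>"
    using s by (auto simp: complex_nonneg_Reals_iff)
  then have "\<bar>Re \<alpha>\<bar> \<le> 1" "\<bar>Im \<alpha>\<bar> \<le> 1" by linarith+
  then show ?thesis
    using cmod_le[of \<alpha>] by (simp add: \<alpha>_def)
qed

lemma compact_quantum_channels: "compact {E :: complex^('n::finite \<times> 'n)^('n \<times> 'n). quantum_channel E}"
proof -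
  have "norm E \<le> (\<Sum>x\<in>(UNIV :: ('n \<times> 'n) set). \<Sum>y\<in>(UNIV :: ('n \<times> 'n) set). 2)" if "quantum_channel E"
    for E :: "complex^('n \<times> 'n)^('n \<times> 'n)"
  proof -
    have "norm E \<le> (\<Sum>x\<in>UNIV. norm (E $ x))"
      by (simp add: norm_vec_def L2_set_le_sum)
    also have "\<dots> \<le> (\<Sum>x\<in>UNIV. \<Sum>y\<in>UNIV. cmod (E $ x $ y))"
      by (intro sum_mono) (simp add: norm_vec_def L2_set_le_sum)
    also have "\<dots> \<le> (\<Sum>x\<in>(UNIV :: ('n \<times> 'n) set). \<Sum>y\<in>(UNIV :: ('n \<times> 'n) set). 2)"
      using quantum_channel_entry_le[OF that] by (intro sum_mono) (metis prod.collapse)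
    finally show ?thesis .
  qed
  then show ?thesis
    unfolding compact_eq_bounded_closed bounded_iff using closed_quantum_channels by blast
qed

subsection \<open>Continuum limits and infinite divisibility\<close>

lemma continuum_limit_imp_infinitely_divisible:
  fixes B :: "nat \<Rightarrow> complex^('n::finite)^'n"
  assumes "has_continuum_limit d B"
  shows "infinitely_divisible (transfer_matrix d B)"
  unfolding infinitely_divisible_def
proof (intro conjI allI impI)
  define E where "E = transfer_matrix d B"
  obtain p F Q where "p > 1"
    and F: "\<forall>l\<ge>1. quantum_channel (F l) \<and> matrix_power (F l) (p ^ l) = E"
    and lim: "\<forall>n l. (\<forall>k. n k \<ge> 1 \<and> l k \<ge> 1) \<and> (\<lambda>k. real (n k) / real (p ^ l k)) \<longlonglongrightarrow> 0
        \<longrightarrow> (\<lambda>k. matrix_power (F (l k)) (n k)) \<longlonglongrightarrow> Q"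
    using assms unfolding has_continuum_limit_def E_def by (elim exE conjE)
  have channel: "quantum_channel (F (Suc k))" and power: "matrix_power (F (Suc k)) (p ^ Suc k) = E" for k
    using F by auto
  show "quantum_channel (transfer_matrix d B)"
    using quantum_channel_matrix_power[OF channel] power unfolding E_def by metis
  fix m :: nat
  assume "m \<ge> 1"
  \<comment> \<open>Bounded exponents have ratios of at most \<open>M / p ^ Suc k\<close>, so the
    continuum limit covers them. The levels are \<open>Suc k\<close> because the conditions on
    \<open>F\<close> start at level 1.\<close>
  have bounded_power: "(\<lambda>k. matrix_power (F (Suc k)) (n k)) \<longlonglongrightarrow> Q"
    if n: "\<And>k. 1 \<le> n k" "\<And>k. n k \<le> M" for n M
  proof (rule lim[rule_format], intro conjI allI)
    have M: "(\<lambda>k. real M / real p ^ Suc k) \<longlonglongrightarrow> 0"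
      using \<open>p > 1\<close> LIMSEQ_Suc[OF LIMSEQ_divide_realpow_zero[of "real p" "real M"]] by simp
    show "(\<lambda>k. real (n k) / real (p ^ Suc k)) \<longlonglongrightarrow> 0"
      by (rule tendsto_sandwich[OF _ _ tendsto_const M])
        (use n(2) in \<open>auto intro!: always_eventually divide_right_mono\<close>)
  qed (use n in auto)
  have Q1: "(\<lambda>k. F (Suc k)) \<longlonglongrightarrow> Q" using bounded_power[of "\<lambda>k. 1" 1] by simp
  \<comment> \<open>Exponents 1 and 2 share the limit, so \<open>Q\<close> is idempotent.\<close>
  have "(\<lambda>k. F (Suc k) ** F (Suc k)) \<longlonglongrightarrow> Q"
    using bounded_power[of "\<lambda>k. 2" 2] by (simp add: numeral_2_eq_2)
  then have QQ: "Q ** Q = Q"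
    using tendsto_matrix_mult[OF Q1 Q1] LIMSEQ_unique by blast
  have "Q \<in> {E. quantum_channel E}"
    by (rule closed_sequentially[OF closed_quantum_channels _ Q1]) (use channel in simp)
  then have Q: "quantum_channel Q" by simp
  \<comment> \<open>Subtracting 1 before the division puts the remainder \<open>r k\<close> between
    1 and \<open>m\<close>: the continuum limit concerns positive exponents.\<close>
  define n where "n k = (p ^ Suc k - 1) div m" for k
  define G where "G k = matrix_power (F (Suc k)) (n k)" for k
  define r where "r k = p ^ Suc k - m * n k" for k
  have r: "m * n k + r k = p ^ Suc k" "1 \<le> r k" "r k \<le> m" for k
  proof -
    have "0 < p ^ Suc k" using \<open>p > 1\<close> by simp
    then have "m * n k + (p ^ Suc k - 1) mod m + 1 = p ^ Suc k"
      unfolding n_def by (metis Suc_eq_plus1 Suc_pred' mult_div_mod_eq diff_Suc_1 One_nat_def)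
    moreover have "(p ^ Suc k - 1) mod m < m" using \<open>m \<ge> 1\<close> by simp
    ultimately show "m * n k + r k = p ^ Suc k" "1 \<le> r k" "r k \<le> m"
      unfolding r_def by linarith+
  qed
  have "G k \<in> {E. quantum_channel E}" for k
    using channel by (simp add: G_def quantum_channel_matrix_power)
  then obtain G' s where G': "quantum_channel G'" and s: "strict_mono (s :: nat \<Rightarrow> nat)"
    and lim_G: "(\<lambda>k. G (s k)) \<longlonglongrightarrow> G'"
    using compact_quantum_channels[where ?'n = 'n] unfolding compact_def comp_def
    by (metis mem_Collect_eq)
  have "matrix_power (G k) m ** matrix_power (F (Suc k)) (r k) = E" for k
    using power[of k] r(1)[of k]
    by (simp add: G_def mult.commute[of _ m] flip: matrix_power_add matrix_power_mult)
  moreover have "(\<lambda>k. matrix_power (G (s k)) m ** matrix_power (F (Suc (s k))) (r (s k)))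
      \<longlonglongrightarrow> matrix_power G' m ** Q"
    using LIMSEQ_subseq_LIMSEQ[OF bounded_power[OF r(2,3)] s]
    by (intro tendsto_intros lim_G) (simp add: comp_def)
  ultimately have E: "matrix_power G' m ** Q = E"
    by (simp add: LIMSEQ_const_iff)
  have lim_F: "(\<lambda>k. F (Suc (s k))) \<longlonglongrightarrow> Q"
    using LIMSEQ_subseq_LIMSEQ[OF Q1 s] by (simp add: comp_def)
  have "G (s k) ** F (Suc (s k)) = F (Suc (s k)) ** G (s k)" for k
    using matrix_power_commute[of "F (Suc (s k))" "n (s k)" 1] by (simp add: G_def)
  then have comm: "G' ** Q = Q ** G'"
    using tendsto_matrix_mult[OF lim_G lim_F] tendsto_matrix_mult[OF lim_F lim_G] LIMSEQ_unique
    by simp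
  \<comment> \<open>Idempotence lets the single factor \<open>Q\<close> count \<open>m\<close>
    times, so that \<open>E\<close> becomes an \<open>m\<close>-th power of
    \<open>G' ** Q\<close>.\<close>
  have "matrix_power Q m = Q" using \<open>m \<ge> 1\<close>
    by (induction m rule: dec_induct) (simp_all add: QQ)
  then have "matrix_power (G' ** Q) m = E"
    using matrix_power_mult_distrib[OF comm] E by simp
  then show "\<exists>F. quantum_channel F \<and> matrix_power F m = transfer_matrix d B"
    using quantum_channel_mult[OF G' Q] unfolding E_def by blast
qed

text \<open>The channels are a compact set closed under powers, and divisibility supplies roots of
  all orders \<open>2 ^ l\<close>, so the chain construction applies with
  \<open>G 0 = E\<close>.\<close>

lemma infinitely_divisible_convergent_roots:
  fixes E :: "complex^('n::finite \<times> 'n)^('n \<times> 'n)"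
  assumes "infinitely_divisible E"
  shows "\<exists>c\<ge>1. \<exists>H Q. (\<forall>j. quantum_channel (H j) \<and> matrix_power (H j) (2 ^ j) = matrix_power E c) \<and>
    (\<forall>n l. (\<forall>k. 1 \<le> n k) \<longrightarrow> (\<lambda>k. real (n k) / 2 ^ l k) \<longlonglongrightarrow> 0 \<longrightarrow>
      (\<lambda>k. matrix_power (H (l k)) (n k)) \<longlonglongrightarrow> Q)"
proof -
  let ?S = "{E :: complex^('n \<times> 'n)^('n \<times> 'n). quantum_channel E}"
  have power: "matrix_power X k \<in> ?S" if "X \<in> ?S" for X k
    using that quantum_channel_matrix_power by blast
  have roots: "\<forall>l. \<exists>R\<in>?S. matrix_power R (2 ^ l) = E"
    using assms unfolding infinitely_divisible_def by simp
  obtain G where G: "G 0 = E" "\<And>l. G l \<in> ?S" "\<And>l. G (Suc l) ** G (Suc l) = G l"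
    using square_root_chain_exists[OF compact_quantum_channels power roots] by blast
  interpret square_root_chain ?S G
    by standard (fact compact_quantum_channels power G)+
  show ?thesis
  proof (rule convergent_roots, intro exI conjI allI impI)
    fix c H Q
    assume "\<And>j. H j \<in> ?S" "\<And>j. matrix_power (H j) (2 ^ j) = matrix_power (G 0) c"
    then show "quantum_channel (H j)" "matrix_power (H j) (2 ^ j) = matrix_power E c" for j
      by (simp_all add: G(1))
  qed
qed

subsection \<open>Blocking\<close>

text \<open>The matrix under the trace in \<open>mps\<close>, kept untraced so that words can be
  concatenated.\<close>

definition word_product :: "(nat \<Rightarrow> complex^'n^'n) \<Rightarrow> nat list \<Rightarrow> complex^'n^'n" where
  "word_product A is = foldr (\<lambda>i M. A i ** M) is (mat 1)"

lemma word_product_simps [simp]: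
  "word_product A [] = mat 1" "word_product A (i # is) = A i ** word_product A is"
  by (simp_all add: word_product_def)

lemma word_product_append: "word_product A (xs @ ys) = word_product A xs ** word_product A ys"
  by (induction xs) (simp_all add: matrix_mul_assoc)

lemma configs_0: "configs d 0 = {[]}"
  by (auto simp: configs_def)

lemma configs_Suc: "configs d (Suc n) = (\<lambda>(i, is). i # is) ` ({..<d} \<times> configs d n)"
  by (auto simp: configs_def length_Suc_conv image_iff)

lemma finite_configs: "finite (configs d n)"
  by (induction n) (simp_all add: configs_0 configs_Suc)

lemma kron_conj_mult:
  "kron (M ** N) (conj_matrix (M ** N)) = kron M (conj_matrix M) ** kron N (conj_matrix N)"
proof -
  have "(\<Sum>k\<in>UNIV. M $ a $ k * N $ k $ c) * cnj (\<Sum>l\<in>UNIV. M $ b $ l * N $ l $ d)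
      = (\<Sum>z\<in>UNIV. M $ a $ fst z * cnj (M $ b $ snd z) * (N $ fst z $ c * cnj (N $ snd z $ d)))" for a b c d
    by (simp add: sum_product sum.cartesian_product case_prod_beta ac_simps)
  then show ?thesis
    by (simp add: kron_def conj_matrix_def matrix_matrix_mult_def vec_eq_iff)
qed

lemma kron_conj_mat_1: "kron (mat 1) (conj_matrix (mat 1)) = mat 1"
  by (auto simp: kron_def conj_matrix_def mat_def vec_eq_iff)

text \<open>Because \<open>kron M (conj_matrix M)\<close> is multiplicative in \<open>M\<close>,
  expanding the power shows that its Kraus operators are the products along words of length
  \<open>n\<close>.\<close>

lemma matrix_power_transfer_matrix:
  "matrix_power (transfer_matrix d A) n
    = (\<Sum>is\<in>configs d n. kron (word_product A is) (conj_matrix (word_product A is)))"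
proof (induction n)
  case 0
  then show ?case by (simp add: configs_0 kron_conj_mat_1)
next
  case (Suc n)
  have "inj_on (\<lambda>(i, is). i # is) ({..<d} \<times> configs d n)"
    by (auto simp: inj_on_def)
  then have "(\<Sum>is\<in>configs d (Suc n). kron (word_product A is) (conj_matrix (word_product A is)))
      = (\<Sum>(i, is)\<in>{..<d} \<times> configs d n.
          kron (A i) (conj_matrix (A i)) ** kron (word_product A is) (conj_matrix (word_product A is)))"
    unfolding configs_Suc by (subst sum.reindex) (auto simp: kron_conj_mult intro!: sum.cong)
  also have "\<dots> = matrix_power (transfer_matrix d A) (Suc n)"
    unfolding matrix_power.simps Suc unfolding transfer_matrix_def
    by (simp add: bounded_bilinear.sum_left[OF bounded_bilinear_matrix_mult]
        bounded_bilinear.sum_right[OF bounded_bilinear_matrix_mult] flip: sum.cartesian_product)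
      (rule sum.swap)
  finally show ?case by simp
qed

text \<open>Each word of length \<open>n\<close> becomes one value of the coarse physical index,
  through a bijection \<open>f\<close>, and carries its product of matrices. \<open>W\<close> sends
  basis vectors to distinct basis vectors, hence is an isometry, and the bond basis is
  unchanged.\<close>

lemma blocking_exists:
  fixes A :: "nat \<Rightarrow> complex^('n::finite)^'n"
  obtains e B where "is_refinement n d A e (B :: nat \<Rightarrow> complex^'n^'n)"
    "transfer_matrix e B = matrix_power (transfer_matrix d A) n"
proof -
  define e where "e = card (configs d n)"
  obtain f where f: "bij_betw f {..<e} (configs d n)"
    using ex_bij_betw_nat_finite[OF finite_configs] unfolding e_def atLeast0LessThan by blast
  define B where "B j = word_product A (f j)" for j
  define g where "g = inv_into {..<e} f"
  define W :: "nat list \<Rightarrow> nat \<Rightarrow> complex" where "W is j = (if is = f j then 1 else 0)" for "is" j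
  have g: "f (g is) = is" "g is < e" if "is \<in> configs d n" for "is"
    using f that bij_betw_inv_into_right[OF f] bij_betw_apply[OF bij_betw_inv_into[OF f]]
    by (auto simp: g_def)
  have "transfer_matrix e B = matrix_power (transfer_matrix d A) n"
    unfolding transfer_matrix_def[of e] B_def matrix_power_transfer_matrix
    by (rule sum.reindex_bij_betw[OF f])
  moreover have "isometry_to_sites d n e W"
    unfolding isometry_to_sites_def
  proof (intro allI impI)
    fix j k
    assume jk: "j < e" "k < e"
    then have fj: "f j \<in> configs d n" and eq: "f j = f k \<longleftrightarrow> j = k"
      using f by (auto simp: bij_betw_def inj_on_def)
    have "(\<Sum>is\<in>configs d n. cnj (W is j) * W is k) = (\<Sum>is\<in>configs d n. if is = f j then W (f j) k else 0)"
      by (rule sum.cong) (auto simp: W_def)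
    also have "\<dots> = (if j = k then 1 else 0)"
      using fj eq by (simp add: finite_configs W_def)
    finally show "(\<Sum>is\<in>configs d n. cnj (W is j) * W is k) = (if j = k then 1 else 0)" .
  qed
  moreover have "mps A (concat iss) = (\<Sum>js\<in>configs e N. (\<Prod>k<N. W (iss ! k) (js ! k)) * mps B js)"
    if iss: "length iss = N" "set iss \<subseteq> configs d n" for N iss
  proof -
    have "word_product B (map g iss) = word_product A (concat iss)"
      using iss(2) by (induction iss) (simp_all add: word_product_append B_def g)
    then have mps: "mps B (map g iss) = mps A (concat iss)"
      by (simp add: mps_def word_product_def)
    \<comment> \<open>For fixed \<open>iss\<close> the product over the sites is a Kronecker delta,
      leaving a single term of the sum.\<close>
    have "(\<Prod>k<N. W (iss ! k) (js ! k)) = (if js = map g iss then 1 else 0)" if "js \<in> configs e N" for js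
    proof (cases "js = map g iss")
      case True
      have "W (iss ! k) (js ! k) = 1" if "k < N" for k
        using that iss g(1)[of "iss ! k"] by (simp add: True W_def subset_iff)
      then show ?thesis by (simp add: True)
    next
      case False
      have js: "length js = N" "\<And>k. k < N \<Longrightarrow> js ! k < e"
        using that by (auto simp: configs_def subset_iff)
      then obtain k where k: "k < N" "js ! k \<noteq> g (iss ! k)"
        using False iss(1) by (auto simp: list_eq_iff_nth_eq)
      have "g (f (js ! k)) = js ! k"
        using bij_betw_inv_into_left[OF f] js k(1) by (simp add: g_def)
      then have "W (iss ! k) (js ! k) = 0" using k(2) by (auto simp: W_def)
      then have "(\<Prod>k<N. W (iss ! k) (js ! k)) = 0" using k(1) by (intro prod_zero) auto
      then show ?thesis using False by simp
    qed
    then have "(\<Sum>js\<in>configs e N. (\<Prod>k<N. W (iss ! k) (js ! k)) * mps B js)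
        = (\<Sum>js\<in>configs e N. if js = map g iss then mps B (map g iss) else 0)"
      by (intro sum.cong) auto
    moreover have "map g iss \<in> configs e N"
      using iss g(2) by (auto simp: configs_def)
    ultimately show ?thesis by (simp add: finite_configs mps)
  qed
  ultimately show thesis
    using that[of e B] unfolding is_refinement_def by blast
qed

theorem corollary5:
  fixes A :: "nat \<Rightarrow> complex^'n^'n" and d :: nat
  assumes "irreducible_form d A"
    and "quantum_channel (transfer_matrix d A)"
  shows "has_coarse_continuum_limit d A \<longleftrightarrow>
    (\<exists>n\<ge>1. infinitely_divisible (matrix_power (transfer_matrix d A) n))"
proof
  assume "has_coarse_continuum_limit d A"
  then show "\<exists>n\<ge>1. infinitely_divisible (matrix_power (transfer_matrix d A) n)"
    unfolding has_coarse_continuum_limit_def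
    using continuum_limit_imp_infinitely_divisible by metis
next
  assume "\<exists>n\<ge>1. infinitely_divisible (matrix_power (transfer_matrix d A) n)"
  then obtain n where "n \<ge> 1" and n: "infinitely_divisible (matrix_power (transfer_matrix d A) n)"
    by blast
  obtain c H Q where "c \<ge> 1"
    and H: "\<forall>j. quantum_channel (H j) \<and>
      matrix_power (H j) (2 ^ j) = matrix_power (matrix_power (transfer_matrix d A) n) c"
    and lim: "\<forall>n l. (\<forall>k. 1 \<le> n k) \<longrightarrow> (\<lambda>k. real (n k) / 2 ^ l k) \<longlonglongrightarrow> 0 \<longrightarrow>
      (\<lambda>k. matrix_power (H (l k)) (n k)) \<longlonglongrightarrow> Q"
    using infinitely_divisible_convergent_roots[OF n] by (elim exE conjE)
  \<comment> \<open>Blocking \<open>n * c\<close> sites absorbs the exponent \<open>c\<close>: the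
    coarse transfer matrix is then the one whose roots of order \<open>2 ^ j\<close> are the
    \<open>H j\<close>, so the base is \<open>p = 2\<close>.\<close>
  obtain e B where ref: "is_refinement (n * c) d A e (B :: nat \<Rightarrow> complex^'n^'n)"
    and B: "transfer_matrix e B = matrix_power (transfer_matrix d A) (n * c)"
    by (rule blocking_exists)
  have "has_continuum_limit e B"
    unfolding has_continuum_limit_def
    by (rule exI[of _ 2], rule exI[of _ H], rule exI[of _ Q])
      (use H lim in \<open>simp add: B matrix_power_mult\<close>)
  moreover have "n * c \<ge> 1" using \<open>n \<ge> 1\<close> \<open>c \<ge> 1\<close> by simp
  ultimately show "has_coarse_continuum_limit d A"
    unfolding has_coarse_continuum_limit_def using ref B by blast
qed

end
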